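(* Let $f,g\in\mathcal X$. (i) If $\Re k>-\tfrac12$, then $$\langle f,g\rangle_{1/4}:=\frac{1}{2\pi a i}\int_{1/4-\pi a i}^{1/4+\pi a i} f(x)\,(Tg)(x)\,\mu(x)\,dx \;=\;\big(f\,T(g)\,\mu\big)_{\rm CT},$$ where the integral is taken along the vertical segment from $\tfrac14-\pi a i$ to $\tfrac14+\pi a i$. (ii) The bilinear form $\langle f,g\rangle:=(f\,T(g)\,\mu)_{\rm CT}$ on $\mathcal X$ is symmetric and satisfies $\langle H(f),g\rangle=\langle f,H^\diamond(g)\rangle$ for all $H\in\mathcal H$, as an identity of meromorphic functions of $k$. Here $\diamond$ is the $\mathbb C$-linear anti-involution of $\mathcal H$ with $T^\diamond=T$, $Y^\diamond=Y$, $X^\diamond=T^{-1}XT$. (iii) For real $k>-\tfrac12$, the form $\langle\cdot,\cdot\rangle_{1/4}$ is positive definite on $\mathbb R[X^{\pm1}]$: $\langle f,f\rangle_{1/4}>0$ for every nonzero $f\in\mathbb R[X^{\pm1}]$.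
   Context: Fix $a>0$ and set $q=e^{-1/a}$. For $k\in\mathbb C$ set $t=q^k$, and for $c\in\mathbb C$ write $q^c:=e^{-c/a}$ (so $t^{1/2}=q^{k/2}$ and $q^{1/4}=e^{-1/(4a)}$). The double affine Hecke algebra (DAHA) $\mathcal H$ of type $A_1$ is the $\mathbb C$-algebra generated by $T,X^{\pm1},Y^{\pm1}$ subject to the relations $TXT=X^{-1}$, $TY^{-1}T=Y$, $Y^{-1}X^{-1}YXT^2=q^{-1/2}$, and $(T-t^{1/2})(T+t^{-1/2})=0$. The polynomial representation of $\mathcal H$ is $\mathcal X=\mathbb C[X^{\pm1}]$. Its elements are regarded as functions of $x\in\mathbb C$ via $X=q^x$. The generators act as follows: $X$ by multiplication; $T\mapsto t^{1/2}s+\frac{t^{1/2}-t^{-1/2}}{q^{2x}-1}(s-1)$; and $Y\mapsto spT$. Here $(sf)(x)=f(-x)$ and $(pf)(x)=f(x+\tfrac12)$, so that $s(X)=X^{-1}$ and $p(X)=q^{1/2}X$. Set $$\mu(x)=\prod_{i\ge0}\frac{(1-q^{i+2x})(1-q^{i+1-2x})}{(1-q^{i+k+2x})(1-q^{i+k+1-2x})}.$$ Constant term: for $\Re k>-\tfrac12$ and $F\in\mathcal X$, $(F\mu)_{\rm CT}$ denotes the coefficient of $X^0$ in the Laurent expansion of $F\mu$ in the annulus $q^{(1+\Re k)/2}<|X|<q^{-\Re k/2}$, on which $\mu$ is holomorphic. As a function of $k$ this extends meromorphically to all $k\in\mathbb C$, and for other $k$ the notation $(F\mu)_{\rm CT}$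 denotes this continuation. *)

theory Defs
  imports "HOL-Analysis.Analysis"
begin

text \<open>Conventions. The parameter a > 0 is fixed and q = e^(-1/a); for complex c,
  q^c := exp(-c/a) (qp a c). Elements of the polynomial representation
  C[X, X^-1] are encoded by their coefficient functions int => complex with
  finite support; lpeval a c x is the associated function of x (X = q^x).\<close>

definition qp :: "real \<Rightarrow> complex \<Rightarrow> complex" where
  "qp a c = exp (- c / complex_of_real a)"

definition fsupp :: "(int \<Rightarrow> complex) \<Rightarrow> bool" where
  "fsupp c \<longleftrightarrow> finite {n. c n \<noteq> 0}"

definition lpeval :: "real \<Rightarrow> (int \<Rightarrow> complex) \<Rightarrow> complex \<Rightarrow> complex" where
  "lpeval a c x = (\<Sum>n\<in>{n. c n \<noteq> 0}. c n * qp a (of_int n * x))"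

text \<open>Multiplication by X and X^-1, s (f(x) -> f(-x)), p (f(x) -> f(x+1/2)) and p^-1,
  written out on coefficients.\<close>

definition Xop :: "(int \<Rightarrow> complex) \<Rightarrow> int \<Rightarrow> complex" where
  "Xop c = (\<lambda>n. c (n - 1))"

definition Xiop :: "(int \<Rightarrow> complex) \<Rightarrow> int \<Rightarrow> complex" where
  "Xiop c = (\<lambda>n. c (n + 1))"

definition sop :: "(int \<Rightarrow> complex) \<Rightarrow> int \<Rightarrow> complex" where
  "sop c = (\<lambda>n. c (- n))"

definition pop :: "real \<Rightarrow> (int \<Rightarrow> complex) \<Rightarrow> int \<Rightarrow> complex" where
  "pop a c = (\<lambda>n. qp a (of_int n / 2) * c n)"

definition piop :: "real \<Rightarrow> (int \<Rightarrow> complex) \<Rightarrow> int \<Rightarrow> complex" where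
  "piop a c = (\<lambda>n. qp a (- of_int n / 2) * c n)"

text \<open>The Demazure-Lusztig operator T (t^(1/2) = q^(k/2)): the unique Laurent polynomial
  whose associated function equals
  t^(1/2) f(-x) + (t^(1/2) - t^(-1/2)) / (q^(2x) - 1) * (f(-x) - f(x))
  wherever q^(2x) <> 1.\<close>

definition Top :: "real \<Rightarrow> complex \<Rightarrow> (int \<Rightarrow> complex) \<Rightarrow> int \<Rightarrow> complex" where
  "Top a k c = (THE d. fsupp d \<and> (\<forall>x. qp a (2 * x) \<noteq> 1 \<longrightarrow>
      lpeval a d x = qp a (k / 2) * lpeval a c (- x)
        + (qp a (k / 2) - qp a (- k / 2)) / (qp a (2 * x) - 1)
          * (lpeval a c (- x) - lpeval a c x)))"

text \<open>T^-1 = T - (t^(1/2) - t^(-1/2)) in the DAHA (quadratic relation).\<close>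

definition Tiop :: "real \<Rightarrow> complex \<Rightarrow> (int \<Rightarrow> complex) \<Rightarrow> int \<Rightarrow> complex" where
  "Tiop a k c = (\<lambda>n. Top a k c n - (qp a (k / 2) - qp a (- k / 2)) * c n)"

definition Yop :: "real \<Rightarrow> complex \<Rightarrow> (int \<Rightarrow> complex) \<Rightarrow> int \<Rightarrow> complex" where
  "Yop a k c = sop (pop a (Top a k c))"

definition Yiop :: "real \<Rightarrow> complex \<Rightarrow> (int \<Rightarrow> complex) \<Rightarrow> int \<Rightarrow> complex" where
  "Yiop a k c = Tiop a k (piop a (sop c))"

text \<open>Elements of the DAHA are represented by noncommutative polynomials in the generators
  T, T^-1, X, X^-1, Y, Y^-1 (the free algebra surjects onto the DAHA): a finite list of
  (coefficient, word) pairs; the word [g1,...,gn] stands for g1 g2 ... gn.\<close>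

datatype gen = GT | GTi | GX | GXi | GY | GYi

fun gen_act :: "real \<Rightarrow> complex \<Rightarrow> gen \<Rightarrow> (int \<Rightarrow> complex) \<Rightarrow> int \<Rightarrow> complex" where
  "gen_act a k GT c = Top a k c"
| "gen_act a k GTi c = Tiop a k c"
| "gen_act a k GX c = Xop c"
| "gen_act a k GXi c = Xiop c"
| "gen_act a k GY c = Yop a k c"
| "gen_act a k GYi c = Yiop a k c"

definition word_act :: "real \<Rightarrow> complex \<Rightarrow> gen list \<Rightarrow> (int \<Rightarrow> complex) \<Rightarrow> int \<Rightarrow> complex" where
  "word_act a k w c = foldr (gen_act a k) w c"

definition hact :: "real \<Rightarrow> complex \<Rightarrow> (complex \<times> gen list) list \<Rightarrow> (int \<Rightarrow> complex) \<Rightarrow> int \<Rightarrow> complex" where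
  "hact a k H c = (\<lambda>n. sum_list (map (\<lambda>(\<alpha>, w). \<alpha> * word_act a k w c n) H))"

fun dia_gen :: "gen \<Rightarrow> gen list" where
  "dia_gen GT = [GT]"
| "dia_gen GTi = [GTi]"
| "dia_gen GX = [GTi, GX, GT]"
| "dia_gen GXi = [GTi, GXi, GT]"
| "dia_gen GY = [GY]"
| "dia_gen GYi = [GYi]"

definition dia_word :: "gen list \<Rightarrow> gen list" where
  "dia_word w = concat (map dia_gen (rev w))"

definition dia :: "(complex \<times> gen list) list \<Rightarrow> (complex \<times> gen list) list" where
  "dia H = map (\<lambda>(\<alpha>, w). (\<alpha>, dia_word w)) H"

definition mu :: "real \<Rightarrow> complex \<Rightarrow> complex \<Rightarrow> complex" where
  "mu a k x = prodinf (\<lambda>i::nat.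
     ((1 - qp a (of_nat i + 2 * x)) * (1 - qp a (of_nat i + 1 - 2 * x))) /
     ((1 - qp a (of_nat i + k + 2 * x)) * (1 - qp a (of_nat i + k + 1 - 2 * x))))"

definition in_annulus :: "real \<Rightarrow> complex \<Rightarrow> complex \<Rightarrow> bool" where
  "in_annulus a k X \<longleftrightarrow>
     cmod (qp a ((1 + of_real (Re k)) / 2)) < cmod X \<and> cmod X < cmod (qp a (- of_real (Re k) / 2))"

text \<open>Constant term (for Re k > -1/2): coefficient of X^0 in the Laurent expansion,
  in X = q^x, of the function Phi of x on the annulus.\<close>

definition CT :: "real \<Rightarrow> complex \<Rightarrow> (complex \<Rightarrow> complex) \<Rightarrow> complex" where
  "CT a k Phi = (THE c0. \<exists>c :: int \<Rightarrow> complex. c 0 = c0 \<and>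
     (\<forall>x. in_annulus a k (qp a x) \<longrightarrow>
        ((\<lambda>n. c n * (qp a x) powi n) has_sum Phi x) UNIV))"

definition integrand :: "real \<Rightarrow> complex \<Rightarrow> (int \<Rightarrow> complex) \<Rightarrow> (int \<Rightarrow> complex) \<Rightarrow> complex \<Rightarrow> complex" where
  "integrand a k f g x = lpeval a f x * lpeval a (Top a k g) x * mu a k x"

definition form :: "real \<Rightarrow> complex \<Rightarrow> (int \<Rightarrow> complex) \<Rightarrow> (int \<Rightarrow> complex) \<Rightarrow> complex" where
  "form a k f g = CT a k (integrand a k f g)"

definition form14 :: "real \<Rightarrow> complex \<Rightarrow> (int \<Rightarrow> complex) \<Rightarrow> (int \<Rightarrow> complex) \<Rightarrow> complex" where
  "form14 a k f g = 1 / (2 * of_real pi * of_real a * \<i>) *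
     integral {- (pi * a) .. pi * a} (\<lambda>y. integrand a k f g (1 / 4 + \<i> * of_real y) * \<i>)"

definition merom_ext :: "(complex \<Rightarrow> complex) \<Rightarrow> (complex \<Rightarrow> complex) \<Rightarrow> complex set \<Rightarrow> bool" where
  "merom_ext F Phi S \<longleftrightarrow> (\<forall>z. \<not> z islimpt S) \<and> F holomorphic_on (- S) \<and>
     (\<forall>k. - 1 / 2 < Re k \<and> k \<notin> S \<longrightarrow> F k = Phi k)"

text \<open>Identity of meromorphic functions of k: equality on Re k > -1/2 (where CT is defined
  directly), and equality of any meromorphic continuations off their singular sets.\<close>

definition mero_eq :: "(complex \<Rightarrow> complex) \<Rightarrow> (complex \<Rightarrow> complex) \<Rightarrow> bool" where
  "mero_eq Phi Psi \<longleftrightarrow> (\<forall>k. - 1 / 2 < Re k \<longrightarrow> Phi k = Psi k) \<and>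
     (\<forall>F G S1 S2. merom_ext F Phi S1 \<and> merom_ext G Psi S2 \<longrightarrow>
        (\<forall>k. k \<notin> S1 \<union> S2 \<longrightarrow> F k = G k))"

end

theory Submission
  imports Defs "HOL-Complex_Analysis.Complex_Analysis"
begin

text \<open>By the q-binomial theorem, \<open>A(z) = \<Prod>i. (1 - q\<^sup>i z) / (1 - q\<^sup>i t z)\<close> has an explicit power
  series on \<open>|t z| < 1\<close>, and \<open>\<mu> = A(X\<^sup>2) A(q X\<^sup>-\<^sup>2)\<close>. Multiplying the two series gives the Laurent
  expansion of \<open>f T(g) \<mu>\<close> on the whole annulus, and integrating it term by term over the line
  \<open>Re x = 1/4\<close>, which lies in the annulus exactly when \<open>Re k > - 1/2\<close>, gives (i).

  Put \<open>\<nu> = A(q X\<^sup>2) A(q X\<^sup>-\<^sup>2)\<close> (called \<open>mut\<close> below). Then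
  \<open>f T(g) \<mu> = t\<^sup>-\<^sup>1\<^sup>/\<^sup>2 f s(g) \<nu> + (t\<^sup>1\<^sup>/\<^sup>2 - t\<^sup>-\<^sup>1\<^sup>/\<^sup>2) f g \<nu> / (1 - t X\<^sup>2)\<close>.
  Moving the contour to \<open>Re x = 0\<close>, where \<open>s\<close> preserves \<open>\<nu>\<close>, the first term is symmetric in
  \<open>f, g\<close>, as is the second. Self-adjointness of \<open>T\<close> is this symmetry, that of \<open>Y = s p T\<close> is
  the invariance of \<open>\<mu>\<close> and of the contour under \<open>x \<mapsto> 1/2 - x\<close>, and \<open>X\<close> acts by multiplication.
  Away from \<open>Re k > - 1/2\<close> the identities follow by analytic continuation.

  For positivity, on \<open>Re x = 0\<close> the integrand is, up to positive factors,
  \<open>|f|\<^sup>2 + (t - 1) Re (f\<^sup>2 / (1 - t X\<^sup>2))\<close>, which is nonnegative because \<open>|1 - t X\<^sup>2| \<ge> |1 - t|\<close>. For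
  \<open>k < 0\<close> the move from \<open>Re x = 1/4\<close> to \<open>Re x = 0\<close> crosses the poles \<open>X = \<plusminus> t\<^sup>-\<^sup>1\<^sup>/\<^sup>2\<close>, which
  contribute positive multiples of the values of \<open>f\<^sup>2 \<nu>\<close> there; these are nonnegative for \<open>k > - 1/2\<close>.\<close>

subsection \<open>Laurent expansions on vertical lines\<close>

lemma qp_add: "qp a (x + y) = qp a x * qp a y"
  by (simp add: qp_def add_divide_distrib diff_divide_distrib flip: exp_add)

lemma qp_0 [simp]: "qp a 0 = 1"
  by (simp add: qp_def)

lemma qp_nonzero [simp]: "qp a x \<noteq> 0"
  by (simp add: qp_def)

lemma qp_minus: "qp a (- x) = inverse (qp a x)"
  by (simp add: qp_def flip: exp_minus)

lemma qp_of_int_mult: "qp a (of_int n * x) = qp a x powi n"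
  by (simp add: qp_def exp_power_int)

lemma qp_of_nat_mult: "qp a (of_nat n * x) = qp a x ^ n"
  using qp_of_int_mult[of a "int n" x] by simp

lemma qp_double: "qp a (2 * x) = qp a x ^ 2"
  using qp_of_nat_mult[of a 2 x] by simp

lemma norm_qp: "norm (qp a x) = exp (- Re x / a)"
  by (simp add: qp_def)

lemma cnj_qp: "cnj (qp a x) = qp a (cnj x)"
  by (simp add: qp_def exp_cnj)

lemma qp_of_real: "qp a (of_real r) = of_real (exp (- r / a))"
  by (simp add: qp_def flip: exp_of_real)

lemma holomorphic_qp [holomorphic_intros]:
  "f holomorphic_on S \<Longrightarrow> (\<lambda>x. qp a (f x)) holomorphic_on S"
  unfolding qp_def divide_inverse by (intro holomorphic_intros)

lemma continuous_on_qp [continuous_intros]: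
  "continuous_on S f \<Longrightarrow> continuous_on S (\<lambda>x. qp a (f x))"
  unfolding qp_def divide_inverse by (intro continuous_intros)

text \<open>Convergence is recorded at a single point \<open>X\<close>, so that one coefficient
  family can be asserted along a line or over an annulus. \<open>has_sum\<close> over the integers
  is unconditional convergence, which in the complex numbers is absolute.\<close>

definition laurent :: "(int \<Rightarrow> complex) \<Rightarrow> complex \<Rightarrow> complex \<Rightarrow> bool" where
  "laurent c X v \<longleftrightarrow> ((\<lambda>n. c n * X powi n) has_sum v) UNIV"

lemma laurent_cmult: "laurent c X v \<Longrightarrow> laurent (\<lambda>n. w * c n) X (w * v)"
  unfolding laurent_def by (drule has_sum_cmult_right[of _ _ _ w]) (simp add: mult.assoc)

lemma laurent_add:
  "laurent c X v \<Longrightarrow> laurent d X w \<Longrightarrow> laurent (\<lambda>n. c n + d n) X (v + w)"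
  unfolding laurent_def by (drule (1) has_sum_add) (simp add: algebra_simps)

lemma laurent_inverse:
  assumes "laurent c (inverse X) v"
  shows "laurent (\<lambda>n. c (- n)) X v"
proof -
  have "((\<lambda>n. c n * inverse X powi n) has_sum v) UNIV"
    using assms by (simp add: laurent_def)
  also have "?this \<longleftrightarrow> ((\<lambda>n. c (- n) * X powi n) has_sum v) UNIV"
    by (rule has_sum_reindex_bij_witness[of _ uminus uminus])
       (auto simp: power_int_minus power_int_inverse)
  finally show ?thesis
    by (simp add: laurent_def)
qed

lemma laurent_shift:
  assumes "laurent c X v" "X \<noteq> 0"
  shows "laurent (\<lambda>n. c (n - m)) X (X powi m * v)"
proof -
  have "((\<lambda>n. X powi m * (c n * X powi n)) has_sum X powi m * v) UNIV"
    using assms by (auto simp: laurent_def intro: has_sum_cmult_right)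
  also have "?this \<longleftrightarrow> ((\<lambda>n. c (n - m) * X powi n) has_sum X powi m * v) UNIV"
    by (rule has_sum_reindex_bij_witness[of _ "\<lambda>n. n - m" "\<lambda>n. n + m"])
       (use assms in \<open>auto simp: power_int_add\<close>)
  finally show ?thesis by (simp add: laurent_def)
qed

text \<open>Absolute convergence turns the product of the sums into a double sum over pairs (m, l),
  regrouped along n = m + l. The second claim, summability of each single convolution, is recorded
  separately because the residue computation subtracts two such convolutions.\<close>

lemma laurent_mult:
  assumes c: "laurent c X u" and d: "laurent d X v" and X: "X \<noteq> 0"
  shows "laurent (\<lambda>n. \<Sum>\<^sub>\<infinity>m. c m * d (n - m)) X (u * v)"
    and "(\<lambda>m. c m * d (n - m)) summable_on UNIV"
proof -
  let ?F = "\<lambda>m. c m * X powi m" and ?G = "\<lambda>l. d l * X powi l"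
  let ?H = "\<lambda>(n, m). (c m * d (n - m)) * X powi n"
  have F: "(?F has_sum u) UNIV" and G: "(?G has_sum v) UNIV"
    using c d by (auto simp: laurent_def)
  have "(\<lambda>m. norm (?F m)) summable_on UNIV" "(\<lambda>l. norm (?G l)) summable_on UNIV"
    using has_sum_imp_summable[OF F] has_sum_imp_summable[OF G]
    by (simp_all add: summable_on_iff_abs_summable_on_complex)
  then have "(\<lambda>p. norm (case p of (m, l) \<Rightarrow> ?F m * ?G l)) summable_on (UNIV \<times> UNIV)"
    by (subst Infinite_Sum.abs_summable_on_Sigma_iff)
       (auto simp: norm_mult infsum_cmult_right' abs_mult infsum_nonneg
             intro!: summable_on_cmult_right summable_on_cmult_left)
  then have "(\<lambda>(m, l). ?F m * ?G l) summable_on (UNIV \<times> UNIV)"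
    by (rule abs_summable_summable)
  then have "((\<lambda>(m, l). ?F m * ?G l) has_sum u * v) (UNIV \<times> UNIV)"
    by (intro has_sum_SigmaI[where g = "\<lambda>m. ?F m * v"])
       (auto intro!: has_sum_cmult_right has_sum_cmult_left F G)
  also have "?this \<longleftrightarrow> (?H has_sum u * v) (UNIV \<times> UNIV)"
    by (rule has_sum_reindex_bij_witness[of _ "\<lambda>(n, m). (m, n - m)" "\<lambda>(m, l). (m + l, m)"])
       (use X in \<open>auto simp: power_int_add\<close>)
  finally have H: "(?H has_sum u * v) (UNIV \<times> UNIV)" .
  have S: "(\<lambda>m. (c m * d (n - m)) * X powi n) summable_on UNIV" for n
    using summable_on_SigmaD1[of "\<lambda>n m. (c m * d (n - m)) * X powi n" UNIV "\<lambda>_. UNIV" n]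
      has_sum_imp_summable[OF H] by simp
  show S': "(\<lambda>m. c m * d (n - m)) summable_on UNIV" for n
    using S[of n] X by (simp add: summable_on_cmult_left')
  show "laurent (\<lambda>n. \<Sum>\<^sub>\<infinity>m. c m * d (n - m)) X (u * v)"
    unfolding laurent_def
    by (rule has_sum_SigmaD[OF H]) (auto intro!: has_sum_cmult_left has_sum_infsum S')
qed

context
  fixes a :: real
  assumes a: "0 < a"
begin

text \<open>Orthogonality of characters: along a vertical line q^x has period 2 pi a in y, which is
  exactly the length of the segment.\<close>

lemma has_integral_qp_powi:
  "((\<lambda>y. qp a (of_real \<sigma> + \<i> * of_real y) powi n) has_integral
     (if n = 0 then 2 * of_real pi * of_real a else 0)) {- (pi * a)..pi * a}"
proof (cases "n = 0")
  case True
  then show ?thesis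
    using a has_integral_const_real[of "1::complex" "- (pi * a)" "pi * a"]
    by (simp add: scaleR_conv_of_real mult.assoc)
next
  case False
  define w :: complex where "w = - (of_int n * \<i> / of_real a)"
  define b :: complex where "b = exp (- (of_int n * of_real \<sigma> / of_real a))"
  have w: "w \<noteq> 0"
    using False a by (simp add: w_def)
  have eq: "qp a (of_real \<sigma> + \<i> * of_real y) powi n = b * exp (w * of_real y)" for y
    using a unfolding qp_of_int_mult[symmetric]
    unfolding qp_def b_def w_def exp_add[symmetric]
    by (intro arg_cong[where f = exp]) (simp add: field_simps)
  have "((\<lambda>y. b * exp (w * of_real y)) has_integral
      b / w * exp (w * of_real (pi * a)) - b / w * exp (w * of_real (- (pi * a))))
      {- (pi * a)..pi * a}"
  proof (rule fundamental_theorem_of_calculus)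
    show "- (pi * a) \<le> pi * a"
      using a by simp
    fix y
    have "((\<lambda>z. b / w * exp (w * z)) has_field_derivative b * exp (w * of_real y)) (at (of_real y))"
      using w by (auto intro!: derivative_eq_intros)
    then show "((\<lambda>y. b / w * exp (w * of_real y)) has_vector_derivative b * exp (w * of_real y))
        (at y within {- (pi * a)..pi * a})"
      by (rule has_vector_derivative_real_field)
  qed
  \<comment> \<open>The two exponents differ by -2 pi i n, so the primitive takes equal values at
    the endpoints.\<close>
  moreover have "exp (w * of_real (pi * a)) = exp (w * of_real (- (pi * a)))"
  proof -
    have "w * of_real (pi * a) = w * of_real (- (pi * a)) + of_int (2 * (- n)) * (of_real pi * \<i>)"
      using a by (simp add: w_def field_simps)
    then show ?thesis
      unfolding exp_eq by (intro exI[of _ "- n"]) (simp add: mult.assoc)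
  qed
  ultimately show ?thesis
    using False by (simp add: eq)
qed

text \<open>The modulus of X is constant on a vertical line, so the terms have norms independent of
  y. The Weierstrass test then gives uniform convergence, and integration term by term leaves only n
  = 0. This stands in for the residue theorem throughout.\<close>

lemma has_integral_laurent:
  assumes "\<And>y. laurent c (qp a (of_real \<sigma> + \<i> * of_real y)) (\<Phi> y)"
  shows "(\<Phi> has_integral (2 * of_real pi * of_real a * c 0)) {- (pi * a)..pi * a}"
proof -
  define M where "M = (\<lambda>n. norm (c n * qp a (of_real \<sigma>) powi n))"
  let ?f = "\<lambda>n y. c n * qp a (of_real \<sigma> + \<i> * of_real y) powi n"
  have "M summable_on UNIV"
    using assms[of 0] unfolding M_def
    by (simp add: laurent_def has_sum_imp_summable flip: summable_on_iff_abs_summable_on_complex)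
  then have lim: "uniform_limit {- (pi * a)..pi * a} (\<lambda>N y. \<Sum>n\<in>N. ?f n y) \<Phi> (finite_subsets_at_top UNIV)"
    by (intro Weierstrass_m_test_general'[where M = M])
       (use assms in \<open>auto simp: M_def laurent_def norm_mult norm_power_int norm_qp\<close>)
  have cont: "continuous_on {- (pi * a)..pi * a} (\<lambda>y. \<Sum>n\<in>N. ?f n y)" for N
    by (intro continuous_intros continuous_on_power_int) auto
  obtain I J where I: "\<And>N. ((\<lambda>y. \<Sum>n\<in>N. ?f n y) has_integral I N) {- (pi * a)..pi * a}"
    and J: "(\<Phi> has_integral J) {- (pi * a)..pi * a}"
    and IJ: "(I \<longlongrightarrow> J) (finite_subsets_at_top UNIV)"
    by (rule uniform_limit_integral[OF lim cont]) auto
  \<comment> \<open>Every finite index set containing 0 already gives the limiting value.\<close>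
  have "I N = 2 * of_real pi * of_real a * c 0" if N: "finite N" "0 \<in> N" for N
  proof -
    have "((\<lambda>y. \<Sum>n\<in>N. ?f n y) has_integral
        (\<Sum>n\<in>N. c n * (if n = 0 then 2 * of_real pi * of_real a else 0))) {- (pi * a)..pi * a}"
      by (intro has_integral_sum has_integral_mult_right has_integral_qp_powi N)
    then have "I N = (\<Sum>n\<in>N. c n * (if n = 0 then 2 * of_real pi * of_real a else 0))"
      using I by (rule has_integral_unique[rotated])
    also have "\<dots> = (\<Sum>n\<in>N. if n = 0 then 2 * of_real pi * of_real a * c 0 else 0)"
      by (intro sum.cong) auto
    finally show ?thesis
      using N by simp
  qed
  then have "eventually (\<lambda>N. I N = 2 * of_real pi * of_real a * c 0) (finite_subsets_at_top UNIV)"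
    by (subst eventually_finite_subsets_at_top) (auto intro!: exI[of _ "{0}"])
  then have "(I \<longlongrightarrow> 2 * of_real pi * of_real a * c 0) (finite_subsets_at_top UNIV)"
    by (rule tendsto_eventually)
  then have "J = 2 * of_real pi * of_real a * c 0"
    using IJ by (intro tendsto_unique[of "finite_subsets_at_top UNIV"]) auto
  then show ?thesis
    using J by simp
qed

text \<open>The coefficient at m is the constant term after multiplication by X^(-m), and constant
  terms are integrals over the given line.\<close>

lemma laurent_unique:
  assumes "\<And>y. laurent c (qp a (of_real \<sigma> + \<i> * of_real y)) (\<Phi> y)"
    and "\<And>y. laurent d (qp a (of_real \<sigma> + \<i> * of_real y)) (\<Phi> y)"
  shows "c = d"
proof
  fix m
  have "2 * of_real pi * of_real a * c (0 + m) = 2 * of_real pi * of_real a * d (0 + m)"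
    using has_integral_unique[OF
        has_integral_laurent[OF laurent_shift[OF assms(1) qp_nonzero, where m = "- m"]]
        has_integral_laurent[OF laurent_shift[OF assms(2) qp_nonzero, where m = "- m"]]]
    by simp
  then show "c m = d m"
    using a by simp
qed

end

subsection \<open>The q-binomial series\<close>

text \<open>In q-Pochhammer notation this is (1/t; q)_n t^n / (q; q)_n, with the powers of t
  absorbed into the product so that it also makes sense at t = 0.\<close>

fun qbin_coeff :: "complex \<Rightarrow> complex \<Rightarrow> nat \<Rightarrow> complex" where
  "qbin_coeff q t 0 = 1"
| "qbin_coeff q t (Suc n) = qbin_coeff q t n * (t - q ^ n) / (1 - q ^ Suc n)"

definition qbin :: "complex \<Rightarrow> complex \<Rightarrow> complex \<Rightarrow> complex" where
  "qbin q t z = (\<Sum>n. qbin_coeff q t n * z ^ n)"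

context
  fixes q t :: complex
  assumes q: "norm q < 1"
begin

lemma one_minus_q_power_nonzero: "1 - q ^ Suc n \<noteq> 0"
proof
  assume "1 - q ^ Suc n = 0"
  then have "norm q ^ Suc n = 1"
    by (metis eq_iff_diff_eq_0 norm_one norm_power)
  moreover have "norm q ^ Suc n < 1"
    using q power_Suc_less_one[of "norm q" n]
    by (metis norm_ge_zero power_less_one_iff zero_less_Suc)
  ultimately show False by simp
qed

text \<open>The ratio of successive terms tends to t z because q^n tends to 0.\<close>

lemma summable_qbin:
  assumes "norm (t * z) < 1"
  shows "summable (\<lambda>n. norm (qbin_coeff q t n * z ^ n))"
proof -
  obtain r where r: "norm (t * z) < r" "r < 1"
    using assms dense by blast
  have q0: "(\<lambda>n. q ^ n) \<longlonglongrightarrow> 0"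
    using q by (rule LIMSEQ_power_zero)
  have "(\<lambda>n. norm ((t - q ^ n) / (1 - q ^ Suc n) * z)) \<longlonglongrightarrow> norm ((t - 0) / (1 - 0) * z)"
    by (intro tendsto_intros q0 LIMSEQ_Suc[OF q0]) auto
  then have "eventually (\<lambda>n. norm ((t - q ^ n) / (1 - q ^ Suc n) * z) < r) sequentially"
    using r by (intro order_tendstoD(2)) auto
  then obtain N where N: "\<And>n. n \<ge> N \<Longrightarrow> norm ((t - q ^ n) / (1 - q ^ Suc n) * z) < r"
    by (auto simp: eventually_sequentially)
  show ?thesis
  proof (rule summable_ratio_test[OF r(2), of N])
    fix n assume "n \<ge> N"
    have "norm (qbin_coeff q t (Suc n) * z ^ Suc n) =
        norm ((t - q ^ n) / (1 - q ^ Suc n) * z) * norm (qbin_coeff q t n * z ^ n)"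
      by (simp add: norm_mult norm_divide norm_power)
    also have "\<dots> \<le> r * norm (qbin_coeff q t n * z ^ n)"
      using N[OF \<open>n \<ge> N\<close>] by (intro mult_right_mono) auto
    finally show "norm (norm (qbin_coeff q t (Suc n) * z ^ Suc n)) \<le> r * norm (norm (qbin_coeff q t n * z ^ n))"
      by simp
  qed
qed

lemma qbin_sums:
  "norm (t * z) < 1 \<Longrightarrow> (\<lambda>n. qbin_coeff q t n * z ^ n) sums qbin q t z"
  unfolding qbin_def by (rule summable_sums[OF summable_norm_cancel[OF summable_qbin]])

text \<open>Comparing the coefficients of z^(n+1) on both sides gives precisely the recursion that
  defines \<open>qbin_coeff\<close>.\<close>

lemma qbin_functional_equation:
  assumes z: "norm (t * z) < 1"
  shows "(1 - t * z) * qbin q t z = (1 - z) * qbin q t (q * z)"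
proof -
  have "norm (t * (q * z)) = norm q * norm (t * z)"
    by (simp add: norm_mult)
  also have "\<dots> \<le> 1 * norm (t * z)"
    using q by (intro mult_right_mono) auto
  finally have qz: "norm (t * (q * z)) < 1"
    using z by simp
  let ?u = "\<lambda>n. qbin_coeff q t n * z ^ n" and ?v = "\<lambda>n. qbin_coeff q t n * (q * z) ^ n"
  have u: "?u sums qbin q t z" and v: "?v sums qbin q t (q * z)"
    using qbin_sums z qz by auto
  have "(\<lambda>n. ?u (Suc n)) sums (qbin q t z - 1)" "(\<lambda>n. ?v (Suc n)) sums (qbin q t (q * z) - 1)"
    using u v sums_Suc_iff[of ?u "qbin q t z - 1"] sums_Suc_iff[of ?v "qbin q t (q * z) - 1"]
    by (simp_all del: qbin_coeff.simps(2) power_Suc)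
  note uv = this
  have "(\<lambda>n. ?u (Suc n) - t * z * ?u n) sums ((qbin q t z - 1) - t * z * qbin q t z)"
    using uv u by (intro sums_diff sums_mult)
  moreover have "(\<lambda>n. ?v (Suc n) - z * ?v n) sums ((qbin q t (q * z) - 1) - z * qbin q t (q * z))"
    using uv v by (intro sums_diff sums_mult)
  moreover have "?u (Suc n) - t * z * ?u n = ?v (Suc n) - z * ?v n" for n
  proof -
    have "qbin_coeff q t (Suc n) * (1 - q ^ Suc n) = qbin_coeff q t n * (t - q ^ n)"
      using one_minus_q_power_nonzero[of n] by simp
    then have "qbin_coeff q t (Suc n) * (1 - q ^ Suc n) * z ^ Suc n = qbin_coeff q t n * (t - q ^ n) * z ^ Suc n"
      by (rule arg_cong)
    then show ?thesis
      by (simp add: algebra_simps power_mult_distrib del: qbin_coeff.simps)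
  qed
  ultimately have "(qbin q t z - 1) - t * z * qbin q t z = (qbin q t (q * z) - 1) - z * qbin q t (q * z)"
    by (simp only: sums_unique2)
  then show ?thesis
    by (simp add: algebra_simps)
qed

lemma one_minus_tqz_nonzero:
  assumes "norm (t * z) < 1"
  shows "1 - q ^ n * t * z \<noteq> 0"
proof
  assume "1 - q ^ n * t * z = 0"
  then have "norm (q ^ n * t * z) = 1"
    by (metis eq_iff_diff_eq_0 norm_one)
  moreover have "norm (q ^ n * t * z) \<le> 1 * norm (t * z)"
    unfolding norm_mult mult.assoc norm_power
    by (intro mult_right_mono power_le_one) (use q in auto)
  ultimately show False
    using assms by simp
qed

lemma qbin_0 : "qbin q t 0 = 1"
  using powser_sums_zero[of "qbin_coeff q t"] by (simp add: qbin_def sums_unique)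

text \<open>Each use of the functional equation splits off one factor and replaces z by q z. The
  remaining value at q^n z tends to the value 1 at the origin, by continuity of the power
  series.\<close>

lemma qbin_prod_tendsto:
  assumes z: "norm (t * z) < 1"
  shows "(\<lambda>n. \<Prod>i\<le>n. (1 - q ^ i * z) / (1 - q ^ i * t * z)) \<longlonglongrightarrow> qbin q t z"
proof -
  have qz: "norm (t * (q ^ n * z)) < 1" for n
  proof -
    have "norm (t * (q ^ n * z)) \<le> 1 * norm (t * z)"
      unfolding mult.left_commute[of t] norm_mult norm_power
      by (intro mult_right_mono power_le_one) (use q in \<open>auto intro: mult_nonneg_nonneg\<close>)
    then show ?thesis using z by simp
  qed
  have partial: "qbin q t z = (\<Prod>i<n. (1 - q ^ i * z) / (1 - q ^ i * t * z)) * qbin q t (q ^ n * z)" for n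
  proof (induction n)
    case (Suc n)
    have "(1 - t * (q ^ n * z)) * qbin q t (q ^ n * z) = (1 - q ^ n * z) * qbin q t (q * (q ^ n * z))"
      by (rule qbin_functional_equation[OF qz])
    then have "qbin q t (q ^ n * z) = (1 - q ^ n * z) / (1 - q ^ n * t * z) * qbin q t (q ^ Suc n * z)"
      using one_minus_tqz_nonzero[OF z, of n] by (simp add: field_simps)
    then show ?case
      using Suc by (simp add: mult.assoc)
  qed simp
  \<comment> \<open>Continuity of a power series at 0 requires a nonzero point of convergence; for t
    = 0 any nonzero point serves.\<close>
  obtain w where w: "norm (t * w) < 1" "w \<noteq> 0"
  proof (cases "t = 0")
    case True
    then show thesis using that[of 1] by simp
  next
    case False
    then show thesis using that[of "1 / (2 * t)"] by (simp add: norm_divide)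
  qed
  have "isCont (\<lambda>z. \<Sum>n. qbin_coeff q t n * z ^ n) 0"
    by (rule isCont_powser[where K = w])
       (use w in \<open>auto intro: summable_norm_cancel[OF summable_qbin]\<close>)
  then have "isCont (qbin q t) 0"
    by (simp add: qbin_def[abs_def])
  moreover have "(\<lambda>n. q ^ Suc n * z) \<longlonglongrightarrow> 0"
    using LIMSEQ_Suc[OF LIMSEQ_power_zero[OF q]] tendsto_mult_left_zero by blast
  ultimately have lim1: "(\<lambda>n. qbin q t (q ^ Suc n * z)) \<longlonglongrightarrow> 1"
    using isCont_tendsto_compose[of 0 "qbin q t" "\<lambda>n. q ^ Suc n * z"] by (simp add: qbin_0)
  then have "(\<lambda>n. qbin q t z / qbin q t (q ^ Suc n * z)) \<longlonglongrightarrow> qbin q t z / 1"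
    by (intro tendsto_intros) auto
  moreover have "eventually (\<lambda>n. qbin q t (q ^ Suc n * z) \<noteq> 0) sequentially"
    using tendsto_imp_eventually_ne[OF lim1, of 0] by simp
  then have "eventually (\<lambda>n. qbin q t z / qbin q t (q ^ Suc n * z) =
      (\<Prod>i\<le>n. (1 - q ^ i * z) / (1 - q ^ i * t * z))) sequentially"
  proof eventually_elim
    case (elim n)
    then show ?case
      by (subst partial[of "Suc n"]) (simp add: lessThan_Suc_atMost)
  qed
  ultimately show ?thesis
    by (simp add: filterlim_cong)
qed

text \<open>The factors differ from 1 by O(|q|^i). Convergence as an infinite product is stronger
  than having a limit of partial products: it also yields nonvanishing from nonvanishing
  factors.\<close>

lemma convergent_prod_qbin:
  assumes z: "norm (t * z) < 1"
  shows "convergent_prod (\<lambda>i. (1 - q ^ i * z) / (1 - q ^ i * t * z))"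
proof (intro abs_convergent_prod_imp_convergent_prod summable_imp_abs_convergent_prod)
  show "summable (\<lambda>i. norm ((1 - q ^ i * z) / (1 - q ^ i * t * z) - 1))"
  proof (rule summable_comparison_test')
    show "summable (\<lambda>i. norm ((t - 1) * z) / (1 - norm (t * z)) * norm q ^ i)"
      using q by (intro summable_mult summable_geometric) auto
    fix i
    have "norm (q ^ i * t * z) \<le> 1 * norm (t * z)"
      unfolding norm_mult mult.assoc norm_power
      by (intro mult_right_mono power_le_one) (use q in auto)
    then have den: "1 - norm (t * z) \<le> norm (1 - q ^ i * t * z)"
      using norm_triangle_ineq2[of 1 "q ^ i * t * z"] by simp
    have "(1 - q ^ i * z) / (1 - q ^ i * t * z) - 1 = q ^ i * ((t - 1) * z) / (1 - q ^ i * t * z)"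
      using one_minus_tqz_nonzero[OF z, of i] by (simp add: field_simps)
    then have "norm ((1 - q ^ i * z) / (1 - q ^ i * t * z) - 1)
        = norm (q ^ i * ((t - 1) * z)) / norm (1 - q ^ i * t * z)"
      by (simp only: norm_divide)
    also have "\<dots> \<le> norm (q ^ i * ((t - 1) * z)) / (1 - norm (t * z))"
      using den z by (intro divide_left_mono mult_pos_pos) auto
    finally show "norm (norm ((1 - q ^ i * z) / (1 - q ^ i * t * z) - 1))
        \<le> norm ((t - 1) * z) / (1 - norm (t * z)) * norm q ^ i"
      by (simp add: norm_mult norm_power mult_ac)
  qed
qed

lemma qbin_eq_prodinf:
  assumes "norm (t * z) < 1"
  shows "qbin q t z = prodinf (\<lambda>i. (1 - q ^ i * z) / (1 - q ^ i * t * z))"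
  using LIMSEQ_unique[OF qbin_prod_tendsto convergent_prod_LIMSEQ[OF convergent_prod_qbin]] assms
  by blast

lemma qbin_nonzero:
  assumes "norm (t * z) < 1" and z: "norm z < 1"
  shows "qbin q t z \<noteq> 0"
proof -
  have "1 - q ^ i * z \<noteq> 0" for i
  proof
    assume "1 - q ^ i * z = 0"
    then have "norm (q ^ i * z) = 1"
      by (metis eq_iff_diff_eq_0 norm_one)
    moreover have "norm (q ^ i * z) \<le> 1 * norm z"
      unfolding norm_mult norm_power by (intro mult_right_mono power_le_one) (use q in auto)
    ultimately show False
      using z by simp
  qed
  then show ?thesis
    unfolding qbin_eq_prodinf[OF assms(1)]
    using one_minus_tqz_nonzero[OF assms(1)] convergent_prod_qbin[OF assms(1)]
    by (intro prodinf_nonzero) auto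
qed

text \<open>With z = w X^2 only even exponents occur. The choices w = 1 and w = q give the two
  halves of the weight, the second after X is replaced by its inverse.\<close>

lemma laurent_qbin_square:
  assumes "norm (t * (w * X ^ 2)) < 1"
  shows "laurent (\<lambda>n. if n \<ge> 0 \<and> even n then qbin_coeff q t (nat (n div 2)) * w ^ nat (n div 2) else 0) X
    (qbin q t (w * X ^ 2))"
proof -
  let ?c = "\<lambda>n::int. if n \<ge> 0 \<and> even n then qbin_coeff q t (nat (n div 2)) * w ^ nat (n div 2) else 0"
  have "((\<lambda>n. qbin_coeff q t n * (w * X ^ 2) ^ n) has_sum qbin q t (w * X ^ 2)) UNIV"
    using summable_qbin[OF assms] qbin_sums[OF assms] by (rule norm_summable_imp_has_sum)
  also have "?this \<longleftrightarrow> ((\<lambda>n. ?c n * X powi n) has_sum qbin q t (w * X ^ 2)) {n. n \<ge> 0 \<and> even n}"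
    by (rule has_sum_reindex_bij_witness[of _ "\<lambda>n. nat (n div 2)" "\<lambda>n. 2 * int n"])
       (auto simp: power_mult_distrib power_int_def nat_mult_distrib simp flip: power_mult)
  also have "\<dots> \<longleftrightarrow> ((\<lambda>n. ?c n * X powi n) has_sum qbin q t (w * X ^ 2)) UNIV"
    by (rule has_sum_cong_neutral) auto
  finally show ?thesis
    by (simp add: laurent_def)
qed

end

subsection \<open>Identities of meromorphic functions\<close>

text \<open>Singular sets without limit points are closed and countable, so their union has an open
  connected complement. The two continuations agree on the part of this complement in the
  half-plane, hence everywhere on it.\<close>

lemma mero_eqI:
  assumes eq: "\<And>k. - 1 / 2 < Re k \<Longrightarrow> \<Phi> k = \<Psi> k"
  shows "mero_eq \<Phi> \<Psi>"
  unfolding mero_eq_def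
proof (intro conjI allI impI eq)
  fix F G S1 S2 k
  assume FG: "merom_ext F \<Phi> S1 \<and> merom_ext G \<Psi> S2" and k: "k \<notin> S1 \<union> S2"
  define S where "S = S1 \<union> S2"
  have "S sparse_in UNIV"
    using FG unfolding S_def merom_ext_def sparse_in_def by (auto simp: islimpt_Un)
  then have S: "closed S" "countable S"
    using sparse_in_UNIV_imp_closed sparse_imp_countable[of UNIV S] by auto
  define U where "U = {z. - 1 / 2 < Re z} - S"
  have "open U"
    unfolding U_def by (intro open_Diff S open_halfspace_Re_gt)
  \<comment> \<open>The disc of radius 1/2 around 0 lies in the half-plane and is uncountable, so it
    cannot consist of singular points only.\<close>
  moreover have "U \<noteq> {}"
  proof
    assume "U = {}"
    then have "z \<in> S" if "norm z < 1 / 2" for z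
      using abs_Re_le_cmod[of z] that by (auto simp: U_def)
    then have "ball 0 (1 / 2) \<subseteq> S"
      by auto
    then show False
      using S(2) countable_subset uncountable_ball[of "1 / 2" "0 :: complex"] by auto
  qed
  moreover have "connected (- S)"
    using connected_open_diff_countable[of "UNIV :: complex set" S] S
    by (simp add: Compl_eq_Diff_UNIV connected_UNIV)
  moreover have "F holomorphic_on - S" "G holomorphic_on - S"
    using FG by (auto simp: S_def merom_ext_def intro: holomorphic_on_subset)
  moreover have "F z = G z" if "z \<in> U" for z
    using FG that eq by (auto simp: U_def S_def merom_ext_def)
  moreover have "open (- S)" "U \<subseteq> - S" "k \<in> - S"
    using S(1) k by (auto simp: U_def S_def[symmetric])
  ultimately show "F k = G k"
    by (intro analytic_continuation_open[of U "- S" F G k]) auto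
qed (use eq in auto)

subsection \<open>Laurent polynomials and the polynomial representation\<close>

lemma laurent_sum:
  assumes "finite S" "\<And>i. i \<in> S \<Longrightarrow> laurent (c i) X (v i)"
  shows "laurent (\<lambda>n. \<Sum>i\<in>S. c i n) X (\<Sum>i\<in>S. v i)"
  using assms
  by (induction S rule: finite_induct) (auto simp: laurent_add, simp add: laurent_def)

lemma laurent_lpeval:
  assumes "fsupp c"
  shows "laurent c (qp a x) (lpeval a c x)"
proof -
  have "((\<lambda>n. c n * qp a x powi n) has_sum lpeval a c x) {n. c n \<noteq> 0}"
    using assms unfolding lpeval_def fsupp_def qp_of_int_mult by (rule has_sum_finite)
  also have "?this \<longleftrightarrow> ((\<lambda>n. c n * qp a x powi n) has_sum lpeval a c x) UNIV"
    by (rule has_sum_cong_neutral) auto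
  finally show ?thesis
    by (simp add: laurent_def)
qed

lemma lpeval_eqI:
  "fsupp c \<Longrightarrow> laurent c (qp a x) v \<Longrightarrow> lpeval a c x = v"
  using laurent_lpeval[of c a x] has_sum_unique unfolding laurent_def by blast

lemma fsupp_shift: "fsupp c \<Longrightarrow> fsupp (\<lambda>n. c (n - m))"
  using finite_vimageI[of "{n. c n \<noteq> 0}" "\<lambda>n. n - m"]
  by (simp add: fsupp_def vimage_def inj_def)

lemma fsupp_sop: "fsupp c \<Longrightarrow> fsupp (sop c)"
  using finite_vimageI[of "{n. c n \<noteq> 0}" uminus]
  by (simp add: fsupp_def sop_def vimage_def)

lemma fsupp_mult: "fsupp c \<Longrightarrow> fsupp (\<lambda>n. w n * c n)"
  unfolding fsupp_def by (rule finite_subset[of _ "{n. c n \<noteq> 0}"]) auto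

lemma fsupp_add: "fsupp c \<Longrightarrow> fsupp d \<Longrightarrow> fsupp (\<lambda>n. c n + d n)"
  unfolding fsupp_def by (rule finite_subset[of _ "{n. c n \<noteq> 0} \<union> {n. d n \<noteq> 0}"]) auto

lemma fsupp_0: "fsupp (\<lambda>n. 0)"
  by (simp add: fsupp_def)

lemma fsupp_sum: "finite S \<Longrightarrow> (\<And>i. i \<in> S \<Longrightarrow> fsupp (c i)) \<Longrightarrow> fsupp (\<lambda>n. \<Sum>i\<in>S. c i n)"
  by (induction S rule: finite_induct) (auto simp: fsupp_add fsupp_0)

lemma fsupp_Xop: "fsupp c \<Longrightarrow> fsupp (Xop c)"
  unfolding Xop_def by (rule fsupp_shift)

lemma fsupp_Xiop: "fsupp c \<Longrightarrow> fsupp (Xiop c)"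
  using fsupp_shift[of c "- 1"] by (simp add: Xiop_def)

lemma fsupp_pop: "fsupp c \<Longrightarrow> fsupp (pop a c)"
  unfolding pop_def by (rule fsupp_mult)

lemma fsupp_piop: "fsupp c \<Longrightarrow> fsupp (piop a c)"
  unfolding piop_def by (rule fsupp_mult)

lemma lpeval_cmult: "fsupp c \<Longrightarrow> lpeval a (\<lambda>n. w * c n) x = w * lpeval a c x"
  by (intro lpeval_eqI fsupp_mult laurent_cmult laurent_lpeval)

lemma lpeval_add:
  "fsupp c \<Longrightarrow> fsupp d \<Longrightarrow> lpeval a (\<lambda>n. c n + d n) x = lpeval a c x + lpeval a d x"
  by (intro lpeval_eqI fsupp_add laurent_add laurent_lpeval)

lemma lpeval_Xop: "fsupp c \<Longrightarrow> lpeval a (Xop c) x = qp a x * lpeval a c x"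
  using laurent_shift[OF laurent_lpeval[of c a x] qp_nonzero, of 1]
  by (auto simp: Xop_def intro!: lpeval_eqI fsupp_shift)

lemma lpeval_Xiop: "fsupp c \<Longrightarrow> lpeval a (Xiop c) x = inverse (qp a x) * lpeval a c x"
  using laurent_shift[OF laurent_lpeval[of c a x] qp_nonzero, of "- 1"] fsupp_Xiop[of c]
  by (auto simp: Xiop_def power_int_minus intro!: lpeval_eqI)

lemma lpeval_sop: "fsupp c \<Longrightarrow> lpeval a (sop c) x = lpeval a c (- x)"
  using laurent_inverse[of c "qp a x" "lpeval a c (- x)"] laurent_lpeval[of c a "- x"]
  by (intro lpeval_eqI fsupp_sop) (auto simp: sop_def qp_minus)

lemma lpeval_pop: "fsupp c \<Longrightarrow> lpeval a (pop a c) x = lpeval a c (x + 1 / 2)"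
proof (intro lpeval_eqI fsupp_pop)
  assume "fsupp c"
  have "qp a (of_int n / 2) = qp a (1 / 2) powi n" for n
    using qp_of_int_mult[of a n "1 / 2"] by simp
  then show "laurent (pop a c) (qp a x) (lpeval a c (x + 1 / 2))"
    using laurent_lpeval[OF \<open>fsupp c\<close>, of a "x + 1 / 2"]
    by (simp add: laurent_def pop_def qp_add power_int_mult_distrib mult_ac)
qed

section \<open>Divided differences and the operators T and Y\<close>

text \<open>Induction through X^(-n-1) - X^(n+1) = X^(-1) (X^(-n) - X^n) - (X^2 - 1) X^(n-1). The
  quotient for n + 1 is thus X^(-1) times the previous one, minus X^(n-1), which is the monomial
  \<open>d\<close> below.\<close>

lemma divided_difference_monomial_nat:
  "\<exists>e. fsupp e \<and> (\<forall>x. (qp a (2 * x) - 1) * lpeval a e x = qp a x powi (- int n) - qp a x powi (int n))"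
proof (induction n)
  case 0
  show ?case
    by (rule exI[of _ "\<lambda>_. 0"]) (simp add: fsupp_0 lpeval_def)
next
  case (Suc n)
  then obtain e where e: "fsupp e"
    "\<And>x. (qp a (2 * x) - 1) * lpeval a e x = qp a x powi (- int n) - qp a x powi (int n)"
    by blast
  define d where "d = (\<lambda>m::int. if m = int n - 1 then - 1 else 0 :: complex)"
  have d: "fsupp d" "lpeval a d x = - (qp a x powi (int n - 1))" for x
  proof -
    have supp: "{m. d m \<noteq> 0} = {int n - 1}"
      by (auto simp: d_def)
    then show "fsupp d"
      by (simp add: fsupp_def)
    show "lpeval a d x = - (qp a x powi (int n - 1))"
      unfolding lpeval_def supp by (simp add: d_def qp_of_int_mult[of a "int n - 1" x, simplified])
  qed
  have "(qp a (2 * x) - 1) * lpeval a (\<lambda>m. Xiop e m + d m) x =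
      qp a x powi (- int (Suc n)) - qp a x powi (int (Suc n))" for x
  proof -
    have "(qp a (2 * x) - 1) * lpeval a (\<lambda>m. Xiop e m + d m) x =
        inverse (qp a x) * ((qp a (2 * x) - 1) * lpeval a e x)
        - (qp a x ^ 2 - 1) * qp a x powi (int n - 1)"
      unfolding qp_double by (simp add: lpeval_add lpeval_Xiop fsupp_Xiop e(1) d algebra_simps)
    also have "\<dots> = inverse (qp a x) * (qp a x powi (- int n) - qp a x powi (int n))
        - (qp a x ^ 2 - 1) * (qp a x powi (int n) * inverse (qp a x))"
      by (simp add: e(2) power_int_diff divide_inverse)
    also have "\<dots> = qp a x powi (- int n) * inverse (qp a x) - qp a x powi (int n) * qp a x"
      by (simp add: field_simps power2_eq_square)
    also have "\<dots> = qp a x powi (- int (Suc n)) - qp a x powi (int (Suc n))"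
      by (simp add: power_int_add power_int_diff power_int_minus field_simps)
    finally show ?thesis .
  qed
  then show ?case
    using fsupp_add[OF fsupp_Xiop[OF e(1)] d(1)] by (intro exI conjI) auto
qed

lemma divided_difference_monomial:
  "\<exists>e. fsupp e \<and> (\<forall>x. (qp a (2 * x) - 1) * lpeval a e x = qp a x powi (- n) - qp a x powi n)"
proof (cases "n \<ge> 0")
  case True
  then show ?thesis
    using divided_difference_monomial_nat[of a "nat n"] by simp
next
  case False
  then obtain e where e: "fsupp e"
    "\<And>x. (qp a (2 * x) - 1) * lpeval a e x = qp a x powi n - qp a x powi (- n)"
    using divided_difference_monomial_nat[of a "nat (- n)"] by auto
  show ?thesis
  proof (intro exI conjI allI)
    show "fsupp (\<lambda>m. - 1 * e m)"
      by (rule fsupp_mult[OF e(1)])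
    show "(qp a (2 * x) - 1) * lpeval a (\<lambda>m. - 1 * e m) x = qp a x powi (- n) - qp a x powi n" for x
      using e(2)[of x] by (subst lpeval_cmult[OF e(1)]) (simp add: algebra_simps)
  qed
qed

lemma divided_difference:
  assumes c: "fsupp c"
  shows "\<exists>e. fsupp e \<and> (\<forall>x. (qp a (2 * x) - 1) * lpeval a e x = lpeval a c (- x) - lpeval a c x)"
proof -
  obtain E where E: "\<And>n. fsupp (E n)"
    "\<And>n x. (qp a (2 * x) - 1) * lpeval a (E n) x = qp a x powi (- n) - qp a x powi n"
    using divided_difference_monomial[of a] by metis
  let ?S = "{n. c n \<noteq> 0}"
  let ?e = "\<lambda>m. \<Sum>n\<in>?S. c n * E n m"
  have S: "finite ?S"
    using c by (simp add: fsupp_def)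
  have e: "fsupp ?e"
    by (intro fsupp_sum S fsupp_mult E)
  have "lpeval a ?e x = (\<Sum>n\<in>?S. c n * lpeval a (E n) x)" for x
    by (intro lpeval_eqI e laurent_sum laurent_cmult laurent_lpeval S E)
  then have "(qp a (2 * x) - 1) * lpeval a ?e x
      = (\<Sum>n\<in>?S. c n * (qp a x powi (- n) - qp a x powi n))" for x
    by (simp add: sum_distrib_left mult.left_commute E(2))
  also have "\<dots> x = lpeval a c (- x) - lpeval a c x" for x
    unfolding lpeval_def qp_of_int_mult
    by (simp add: qp_minus power_int_inverse power_int_minus algebra_simps sum_subtractf)
  finally show ?thesis
    using e by blast
qed

lemma hact_Cons: "hact a k ((w, \<gamma>) # H) c = (\<lambda>n. w * word_act a k \<gamma> c n + hact a k H c n)"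
  by (simp add: hact_def)

lemma hact_Nil: "hact a k [] c = (\<lambda>n. 0)"
  by (simp add: hact_def)

context
  fixes a :: real
  assumes a: "0 < a"
begin

lemma qp_double_neq_1: "Re x \<noteq> 0 \<Longrightarrow> qp a (2 * x) \<noteq> 1"
proof
  assume "Re x \<noteq> 0" "qp a (2 * x) = 1"
  then have "exp (- (2 * Re x) / a) = 1"
    using norm_qp[of a "2 * x"] by simp
  then show False
    using a \<open>Re x \<noteq> 0\<close> by simp
qed

text \<open>The excluded points all have real part 0, so comparison on the line Re x = 1 avoids
  them.\<close>

lemma lpeval_unique:
  assumes "fsupp c" "fsupp d" "\<And>x. qp a (2 * x) \<noteq> 1 \<Longrightarrow> lpeval a c x = lpeval a d x"
  shows "c = d"
proof (rule laurent_unique[OF a, of _ 1])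
  show "laurent c (qp a (of_real 1 + \<i> * of_real y)) (lpeval a c (of_real 1 + \<i> * of_real y))" for y
    by (rule laurent_lpeval[OF assms(1)])
  show "laurent d (qp a (of_real 1 + \<i> * of_real y)) (lpeval a c (of_real 1 + \<i> * of_real y))" for y
    by (subst assms(3), rule qp_double_neq_1, simp, rule laurent_lpeval[OF assms(2)])
qed

text \<open>This resolves the definite description in \<open>Top\<close>: divisibility of s(f) - f
  by X^2 - 1 gives existence, and \<open>lpeval_unique\<close> gives uniqueness.\<close>

lemma Top_spec:
  assumes "fsupp c"
  shows "fsupp (Top a k c) \<and> (\<forall>x. qp a (2 * x) \<noteq> 1 \<longrightarrow>
      lpeval a (Top a k c) x = qp a (k / 2) * lpeval a c (- x)
        + (qp a (k / 2) - qp a (- k / 2)) / (qp a (2 * x) - 1)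
          * (lpeval a c (- x) - lpeval a c x))"
proof -
  let ?P = "\<lambda>d. fsupp d \<and> (\<forall>x. qp a (2 * x) \<noteq> 1 \<longrightarrow>
      lpeval a d x = qp a (k / 2) * lpeval a c (- x)
        + (qp a (k / 2) - qp a (- k / 2)) / (qp a (2 * x) - 1)
          * (lpeval a c (- x) - lpeval a c x))"
  obtain e where e: "fsupp e"
    "\<And>x. (qp a (2 * x) - 1) * lpeval a e x = lpeval a c (- x) - lpeval a c x"
    using divided_difference[OF assms, of a] by blast
  let ?d = "\<lambda>n. qp a (k / 2) * sop c n + (qp a (k / 2) - qp a (- k / 2)) * e n"
  have "lpeval a ?d x = qp a (k / 2) * lpeval a c (- x)
      + (qp a (k / 2) - qp a (- k / 2)) * lpeval a e x" for x
    using assms e(1)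
    by (simp add: lpeval_add lpeval_cmult lpeval_sop fsupp_mult fsupp_sop)
  moreover have "lpeval a e x = (lpeval a c (- x) - lpeval a c x) / (qp a (2 * x) - 1)"
    if "qp a (2 * x) \<noteq> 1" for x
    using e(2)[of x] that by (simp add: eq_divide_eq mult.commute)
  moreover have "fsupp ?d"
    by (intro fsupp_add fsupp_mult fsupp_sop assms e(1))
  ultimately have P: "?P ?d"
    by simp
  have "d = d'" if "?P d" "?P d'" for d d'
  proof (rule lpeval_unique)
    show "fsupp d" "fsupp d'"
      using that by blast+
    show "lpeval a d x = lpeval a d' x" if "qp a (2 * x) \<noteq> 1" for x
      using \<open>?P d\<close>[THEN conjunct2, rule_format, OF that]
        \<open>?P d'\<close>[THEN conjunct2, rule_format, OF that] by (simp only:)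
  qed
  with P have "\<exists>!d. ?P d"
    by blast
  then have "?P (THE d. ?P d)"
    by (rule theI')
  then show ?thesis
    unfolding Top_def .
qed

lemma fsupp_Top: "fsupp c \<Longrightarrow> fsupp (Top a k c)"
  using Top_spec by blast

lemma lpeval_Top:
  assumes "fsupp c" "qp a (2 * x) \<noteq> 1"
  shows "lpeval a (Top a k c) x = qp a (k / 2) * lpeval a c (- x)
        + (qp a (k / 2) - qp a (- k / 2)) / (qp a (2 * x) - 1)
          * (lpeval a c (- x) - lpeval a c x)"
  using Top_spec[OF assms(1)] assms(2) by blast

lemma fsupp_Tiop: "fsupp c \<Longrightarrow> fsupp (Tiop a k c)"
  using fsupp_add[OF fsupp_Top[of c k] fsupp_mult[of c "\<lambda>_. - (qp a (k / 2) - qp a (- k / 2))"]]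
  by (simp add: Tiop_def algebra_simps)

lemma lpeval_Tiop:
  assumes "fsupp c"
  shows "lpeval a (Tiop a k c) x =
    lpeval a (Top a k c) x - (qp a (k / 2) - qp a (- k / 2)) * lpeval a c x"
proof -
  let ?w = "- (qp a (k / 2) - qp a (- k / 2))"
  have "Tiop a k c = (\<lambda>n. Top a k c n + ?w * c n)"
    by (simp add: Tiop_def algebra_simps)
  then have "lpeval a (Tiop a k c) x = lpeval a (\<lambda>n. Top a k c n + ?w * c n) x"
    by simp
  also have "\<dots> = lpeval a (Top a k c) x + ?w * lpeval a c x"
    by (subst lpeval_add) (auto intro: fsupp_Top fsupp_mult assms simp: lpeval_cmult[OF assms])
  finally show ?thesis
    by (simp add: algebra_simps)
qed

text \<open>This is the quadratic relation for T, checked on values. T acts on the pair (f(x),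
  f(-x)) by a 2 by 2 matrix whose entries involve z = X^2 at x and 1/z at -x.\<close>

lemma Top_Tiop:
  assumes c: "fsupp c"
  shows "Top a k (Tiop a k c) = c"
proof (rule lpeval_unique)
  fix x assume x: "qp a (2 * x) \<noteq> 1"
  then have x': "qp a (2 * (- x)) \<noteq> 1"
    by (simp add: qp_minus inverse_eq_1_iff)
  define h h' z u v where "h = qp a (k / 2)" and "h' = qp a (- k / 2)" and "z = qp a (2 * x)"
    and "u = lpeval a c x" and "v = lpeval a c (- x)"
  have h: "h * h' = 1"
    by (simp add: h_def h'_def flip: qp_add)
  have z: "z \<noteq> 0" "z \<noteq> 1" "qp a (2 * (- x)) = inverse z"
    using x by (simp_all add: z_def qp_minus)
  have iz: "inverse z - 1 \<noteq> 0"
    using z by (simp add: field_simps)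
  define p where "p = h * v + (h - h') / (z - 1) * (v - u) - (h - h') * u"
  define r where "r = h * u + (h - h') / (inverse z - 1) * (u - v) - (h - h') * v"
  have p: "lpeval a (Tiop a k c) x = p"
    using c x by (simp add: lpeval_Tiop lpeval_Top p_def u_def v_def h_def h'_def z_def)
  have r: "lpeval a (Tiop a k c) (- x) = r"
    using c x' z(3) by (simp add: lpeval_Tiop lpeval_Top r_def u_def v_def h_def h'_def)
  have "h * r + (h - h') / (z - 1) * (r - p) = u"
  proof -
    have "(h - h') / (inverse z - 1) = - z * (h - h') / (z - 1)"
      using z iz by (simp add: divide_simps) (simp add: algebra_simps)
    then have r': "(z - 1) * r = (z - 1) * h * u - z * (h - h') * (u - v) - (z - 1) * (h - h') * v"
      using z by (simp add: r_def field_simps)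
    have p': "(z - 1) * p = (z - 1) * h * v + (h - h') * (v - u) - (z - 1) * (h - h') * u"
      using z by (simp add: p_def field_simps)
    \<comment> \<open>Clearing both denominators leaves a polynomial identity, in which only h h' =
      1 remains to be used.\<close>
    have "(z - 1) ^ 2 * (h * r + (h - h') / (z - 1) * (r - p))
        = (z - 1) * h * ((z - 1) * r) + (h - h') * ((z - 1) * r - (z - 1) * p)"
      using z by (simp add: field_simps power2_eq_square)
    also have "\<dots> = (z - 1) ^ 2 * (h * h') * u"
      unfolding r' p' by (simp add: algebra_simps power2_eq_square)
    finally have "(z - 1) ^ 2 * (h * r + (h - h') / (z - 1) * (r - p)) = (z - 1) ^ 2 * u"
      by (simp add: h)
    then show ?thesis
      using z by simp
  qed
  then show "lpeval a (Top a k (Tiop a k c)) x = lpeval a c x"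
    using x c by (simp add: lpeval_Top fsupp_Tiop p r u_def h_def h'_def z_def)
qed (auto intro: fsupp_Top fsupp_Tiop c)

lemma fsupp_Yop: "fsupp c \<Longrightarrow> fsupp (Yop a k c)"
  by (simp add: Yop_def fsupp_sop fsupp_pop fsupp_Top)

lemma fsupp_Yiop: "fsupp c \<Longrightarrow> fsupp (Yiop a k c)"
  by (simp add: Yiop_def fsupp_sop fsupp_piop fsupp_Tiop)

lemma lpeval_Yop: "fsupp c \<Longrightarrow> lpeval a (Yop a k c) x = lpeval a (Top a k c) (1 / 2 - x)"
  by (simp add: Yop_def lpeval_sop lpeval_pop fsupp_pop fsupp_Top)

lemma Yop_Yiop:
  assumes "fsupp c"
  shows "Yop a k (Yiop a k c) = c"
proof -
  have "Yop a k (Yiop a k c) = sop (pop a (piop a (sop c)))"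
    using assms by (simp add: Yop_def Yiop_def Top_Tiop fsupp_piop fsupp_sop)
  also have "\<dots> = c"
    by (simp add: sop_def pop_def piop_def fun_eq_iff flip: qp_add mult.assoc)
  finally show ?thesis .
qed

lemma fsupp_gen_act: "fsupp c \<Longrightarrow> fsupp (gen_act a k \<gamma> c)"
  by (cases \<gamma>) (auto simp: fsupp_Top fsupp_Tiop fsupp_Xop fsupp_Xiop fsupp_Yop fsupp_Yiop)

lemma fsupp_word_act: "fsupp c \<Longrightarrow> fsupp (word_act a k w c)"
  by (induction w) (auto simp: word_act_def fsupp_gen_act)

lemma fsupp_hact: "fsupp c \<Longrightarrow> fsupp (hact a k H c)"
  by (induction H) (auto simp: hact_Cons hact_Nil fsupp_0 fsupp_add fsupp_mult fsupp_word_act)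

end

subsection \<open>The weight function and the bilinear form\<close>

text \<open>The part of \<open>mu\<close> that is invariant under \<open>x \<mapsto> - x\<close>:
  \<open>mu = (1 - X\<^sup>2) / (1 - t X\<^sup>2) \<cdot> mut\<close>.\<close>

definition mut :: "real \<Rightarrow> complex \<Rightarrow> complex \<Rightarrow> complex" where
  "mut a k x = qbin (qp a 1) (qp a k) (qp a 1 * qp a x ^ 2) * qbin (qp a 1) (qp a k) (qp a 1 * qp a (- x) ^ 2)"

lemma mut_minus: "mut a k (- x) = mut a k x"
  by (simp add: mut_def mult.commute)

text \<open>Replacing 2x by 1 - 2x swaps the two factors of each numerator and of each
  denominator.\<close>

lemma mu_reflect: "mu a k (1 / 2 - x) = mu a k x"
proof -
  have "2 * (1 / 2 - x) = 1 - 2 * x"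
    by (simp add: algebra_simps)
  then show ?thesis
    unfolding mu_def by (simp add: algebra_simps)
qed

context
  fixes a :: real and k :: complex
  assumes a: "0 < a" and k: "- 1 / 2 < Re k"
begin

lemma norm_qp_1: "norm (qp a 1) < 1"
  using a by (simp add: norm_qp)

lemma norm_qp_less_1: "0 < Re x \<Longrightarrow> norm (qp a x) < 1"
  using a by (simp add: norm_qp)

lemma in_annulus_qp: "in_annulus a k (qp a x) \<longleftrightarrow> - Re k / 2 < Re x \<and> Re x < (1 + Re k) / 2"
  using a by (auto simp: in_annulus_def norm_qp field_simps)

text \<open>Without the factor 1 / (1 - t X^2) the expansion is valid on a wider strip, which
  contains both Re x = 0 and Re x = 1/4 whenever Re k > -1/2.\<close>

lemma laurent_mut: "\<exists>c. \<forall>x. \<bar>Re x\<bar> < (1 + Re k) / 2 \<longrightarrow> laurent c (qp a x) (mut a k x)"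
proof -
  define c where "c = (\<lambda>n::int. if n \<ge> 0 \<and> even n
    then qbin_coeff (qp a 1) (qp a k) (nat (n div 2)) * qp a 1 ^ nat (n div 2) else 0)"
  have half: "laurent c (qp a x) (qbin (qp a 1) (qp a k) (qp a 1 * qp a x ^ 2))"
    if "- (1 + Re k) / 2 < Re x" for x
    unfolding c_def
  proof (rule laurent_qbin_square[OF norm_qp_1])
    have "qp a k * (qp a 1 * qp a x ^ 2) = qp a (k + 1 + 2 * x)"
      by (simp add: qp_add qp_double)
    then show "norm (qp a k * (qp a 1 * qp a x ^ 2)) < 1"
      using norm_qp_less_1[of "k + 1 + 2 * x"] that by simp
  qed
  have "laurent (\<lambda>n. \<Sum>\<^sub>\<infinity>m. c m * c (- (n - m))) (qp a x) (mut a k x)"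
    if "\<bar>Re x\<bar> < (1 + Re k) / 2" for x
  proof -
    have "laurent c (inverse (qp a x)) (qbin (qp a 1) (qp a k) (qp a 1 * qp a (- x) ^ 2))"
      using half[of "- x"] that by (simp add: qp_minus abs_if split: if_splits)
    then have "laurent (\<lambda>n. c (- n)) (qp a x) (qbin (qp a 1) (qp a k) (qp a 1 * qp a (- x) ^ 2))"
      by (rule laurent_inverse)
    moreover have "laurent c (qp a x) (qbin (qp a 1) (qp a k) (qp a 1 * qp a x ^ 2))"
      using half[of x] that by (simp add: abs_if split: if_splits)
    ultimately show ?thesis
      unfolding mut_def by (intro laurent_mult(1)) auto
  qed
  then show ?thesis
    by blast
qed

text \<open>The two bounds on Re x say exactly that |t X^2| < 1 and |t q X^(-2)| < 1, so both
  q-binomial series converge.\<close>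

lemma mu_eq_qbin:
  assumes x: "- Re k / 2 < Re x" "Re x < (1 + Re k) / 2"
  shows "mu a k x = qbin (qp a 1) (qp a k) (qp a x ^ 2) * qbin (qp a 1) (qp a k) (qp a 1 * qp a (- x) ^ 2)"
proof -
  let ?q = "qp a 1" and ?t = "qp a k"
  define z z' where "z = qp a x ^ 2" and "z' = ?q * qp a (- x) ^ 2"
  have "?t * z = qp a (k + 2 * x)" "?t * z' = qp a (k + 1 + 2 * (- x))"
    unfolding z_def z'_def qp_add qp_double by simp_all
  then have z: "norm (?t * z) < 1" "norm (?t * z') < 1"
    using norm_qp_less_1[of "k + 2 * x"] norm_qp_less_1[of "k + 1 + 2 * (- x)"] x by simp_all
  let ?u = "\<lambda>z i. (1 - ?q ^ i * z) / (1 - ?q ^ i * ?t * z)"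
  have q: "qp a (of_nat i) = ?q ^ i" for i
    using qp_of_nat_mult[of a i 1] by simp
  have mu: "mu a k x = prodinf (\<lambda>i. ?u z i * ?u z' i)"
    unfolding mu_def
  proof (rule arg_cong[where f = prodinf], rule ext)
    fix i
    have "qp a (of_nat i + 2 * x) = ?q ^ i * z" "qp a (of_nat i + 1 - 2 * x) = ?q ^ i * z'"
      "qp a (of_nat i + k + 2 * x) = ?q ^ i * ?t * z" "qp a (of_nat i + k + 1 - 2 * x) = ?q ^ i * ?t * z'"
      using qp_add[of a "of_nat i + 1" "2 * (- x)"] qp_add[of a "of_nat i + k + 1" "2 * (- x)"]
      by (simp_all add: z_def z'_def qp_add q qp_double[of a x] qp_double[of a "- x", simplified])
    then show "((1 - qp a (of_nat i + 2 * x)) * (1 - qp a (of_nat i + 1 - 2 * x))) /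
      ((1 - qp a (of_nat i + k + 2 * x)) * (1 - qp a (of_nat i + k + 1 - 2 * x))) = ?u z i * ?u z' i"
      by simp
  qed
  have "(\<lambda>n. \<Prod>i\<le>n. ?u z i * ?u z' i) \<longlonglongrightarrow> prodinf (\<lambda>i. ?u z i * ?u z' i)"
    by (intro convergent_prod_LIMSEQ convergent_prod_mult convergent_prod_qbin norm_qp_1 z)
  moreover have "(\<lambda>n. \<Prod>i\<le>n. ?u z i * ?u z' i) \<longlonglongrightarrow> qbin ?q ?t z * qbin ?q ?t z'"
    unfolding prod.distrib by (intro tendsto_mult qbin_prod_tendsto norm_qp_1 z)
  ultimately have "prodinf (\<lambda>i. ?u z i * ?u z' i) = qbin ?q ?t z * qbin ?q ?t z'"
    by (rule LIMSEQ_unique)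
  then show ?thesis
    unfolding mu z_def z'_def .
qed

text \<open>One application of the functional equation at z = X^2.\<close>

lemma mu_eq_mut:
  assumes x: "- Re k / 2 < Re x" "Re x < (1 + Re k) / 2"
  shows "(1 - qp a k * qp a (2 * x)) * mu a k x = (1 - qp a (2 * x)) * mut a k x"
proof -
  have "norm (qp a k * qp a x ^ 2) < 1"
    using norm_qp_less_1[of "k + 2 * x"] x by (simp add: qp_add qp_double)
  from qbin_functional_equation[OF norm_qp_1 this] show ?thesis
    unfolding mu_eq_qbin[OF x] mut_def qp_double by (simp add: mult.assoc[symmetric])
qed

lemma laurent_mu: "\<exists>c. \<forall>x. in_annulus a k (qp a x) \<longrightarrow> laurent c (qp a x) (mu a k x)"
proof -
  let ?q = "qp a 1" and ?t = "qp a k"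
  define c where "c = (\<lambda>w (n::int). if n \<ge> 0 \<and> even n
    then qbin_coeff ?q ?t (nat (n div 2)) * w ^ nat (n div 2) else 0)"
  have "laurent (\<lambda>n. \<Sum>\<^sub>\<infinity>m. c 1 m * c ?q (- (n - m))) (qp a x) (mu a k x)"
    if "in_annulus a k (qp a x)" for x
  proof -
    have x: "- Re k / 2 < Re x" "Re x < (1 + Re k) / 2"
      using that by (simp_all add: in_annulus_qp)
    have "?t * (1 * qp a x ^ 2) = qp a (k + 2 * x)" "?t * (?q * qp a (- x) ^ 2) = qp a (k + 1 + 2 * (- x))"
      unfolding qp_add qp_double by simp_all
    then have "norm (?t * (1 * qp a x ^ 2)) < 1" "norm (?t * (?q * qp a (- x) ^ 2)) < 1"
      using norm_qp_less_1[of "k + 2 * x"] norm_qp_less_1[of "k + 1 + 2 * (- x)"] x by simp_all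
    from laurent_qbin_square[OF norm_qp_1 this(1)] laurent_qbin_square[OF norm_qp_1 this(2)]
    have "laurent (c 1) (qp a x) (qbin ?q ?t (qp a x ^ 2))"
      "laurent (c ?q) (inverse (qp a x)) (qbin ?q ?t (?q * qp a (- x) ^ 2))"
      by (simp_all add: c_def qp_minus)
    from this(1) laurent_inverse[OF this(2)] show ?thesis
      unfolding mu_eq_qbin[OF x] by (rule laurent_mult(1)) auto
  qed
  then show ?thesis
    by blast
qed

lemma laurent_integrand:
  assumes f: "fsupp f" and g: "fsupp g"
  shows "\<exists>c. \<forall>x. in_annulus a k (qp a x) \<longrightarrow> laurent c (qp a x) (integrand a k f g x)"
proof -
  obtain c where c: "\<And>x. in_annulus a k (qp a x) \<Longrightarrow> laurent c (qp a x) (mu a k x)"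
    using laurent_mu by blast
  show ?thesis
    unfolding integrand_def
    by (rule exI, intro allI impI, rule laurent_mult(1)[OF laurent_mult(1)[OF
            laurent_lpeval[OF f] laurent_lpeval[OF fsupp_Top[OF a g]]] c]) simp_all
qed

section \<open>The constant term as an integral over Re x = 1/4\<close>

text \<open>The line Re x = 1/4 lies in the annulus because Re k > -1/2, and a Laurent expansion is
  determined on one line. This makes the definite description in \<open>CT\<close> well
  defined.\<close>

lemma CT_eq:
  assumes "\<And>x. in_annulus a k (qp a x) \<Longrightarrow> laurent c (qp a x) (\<Phi> x)"
  shows "CT a k \<Phi> = c 0"
  unfolding CT_def
proof (rule the_equality)
  show "\<exists>d. d 0 = c 0 \<and> (\<forall>x. in_annulus a k (qp a x) \<longrightarrow> ((\<lambda>n. d n * qp a x powi n) has_sum \<Phi> x) UNIV)"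
    using assms by (auto simp: laurent_def)
  fix c0
  assume "\<exists>d. d 0 = c0 \<and> (\<forall>x. in_annulus a k (qp a x) \<longrightarrow> ((\<lambda>n. d n * qp a x powi n) has_sum \<Phi> x) UNIV)"
  then obtain d where d: "d 0 = c0" "\<And>x. in_annulus a k (qp a x) \<Longrightarrow> laurent d (qp a x) (\<Phi> x)"
    by (auto simp: laurent_def)
  have "in_annulus a k (qp a (of_real (1 / 4) + \<i> * of_real y))" for y
    using k by (simp add: in_annulus_qp)
  then have "d = c"
    by (intro laurent_unique[OF a, where \<sigma> = "1 / 4"
          and \<Phi> = "\<lambda>y. \<Phi> (of_real (1 / 4) + \<i> * of_real y)"] d(2) assms)
  then show "c0 = c 0"
    using d(1) by simp
qed

text \<open>From here on, identities between values of the form are proved by comparing integrands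
  on this line.\<close>

lemma form_has_integral:
  assumes "fsupp f" "fsupp g"
  shows "((\<lambda>y. integrand a k f g (1 / 4 + \<i> * of_real y)) has_integral (2 * of_real pi * of_real a * form a k f g))
    {- (pi * a)..pi * a}"
proof -
  obtain c where c: "\<And>x. in_annulus a k (qp a x) \<Longrightarrow> laurent c (qp a x) (integrand a k f g x)"
    using laurent_integrand[OF assms] by blast
  have "in_annulus a k (qp a (of_real (1 / 4) + \<i> * of_real y))" for y
    using k by (simp add: in_annulus_qp)
  then have "laurent c (qp a (of_real (1 / 4) + \<i> * of_real y)) (integrand a k f g (1 / 4 + \<i> * of_real y))" for y
    using c[of "1 / 4 + \<i> * of_real y"] by simp
  from has_integral_laurent[OF a this] show ?thesis
    by (simp add: form_def CT_eq[OF c])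
qed

lemma form14_eq_form:
  assumes "fsupp f" "fsupp g"
  shows "form14 a k f g = form a k f g"
proof -
  have "integral {- (pi * a)..pi * a} (\<lambda>y. integrand a k f g (1 / 4 + \<i> * of_real y) * \<i>)
      = 2 * of_real pi * of_real a * form a k f g * \<i>"
    by (intro integral_unique has_integral_mult_left form_has_integral assms)
  then show ?thesis
    using a by (simp add: form14_def)
qed

lemma form_cong:
  assumes "fsupp f" "fsupp g" "fsupp f'" "fsupp g'"
    and "\<And>y. integrand a k f g (1 / 4 + \<i> * of_real y) = integrand a k f' g' (1 / 4 + \<i> * of_real y)"
  shows "form a k f g = form a k f' g'"
  using has_integral_unique[OF form_has_integral[OF assms(1,2)]
      form_has_integral[OF assms(3,4), folded assms(5)]] a
  by simp

text \<open>The total coefficient of g(-x) is a multiple of 1 - t X^2, which cancels the denominator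
  of the weight. Only the term with g(x), symmetric in f and g, keeps the poles at t X^2 =
  1.\<close>

lemma integrand_eq:
  assumes f: "fsupp f" and g: "fsupp g"
    and x: "- Re k / 2 < Re x" "Re x < (1 + Re k) / 2" "qp a (2 * x) \<noteq> 1"
  shows "integrand a k f g x = qp a (- k / 2) * lpeval a f x * lpeval a g (- x) * mut a k x
    + (qp a (k / 2) - qp a (- k / 2)) * (lpeval a f x * lpeval a g x * mut a k x / (1 - qp a k * qp a (2 * x)))"
proof -
  define h h' z u v f' where "h = qp a (k / 2)" and "h' = qp a (- k / 2)" and "z = qp a (2 * x)"
    and "u = lpeval a g x" and "v = lpeval a g (- x)" and "f' = lpeval a f x"
  have h: "qp a k = h * h" "h' * h * h = h"
    by (simp_all add: h_def h'_def flip: qp_add)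
  have "norm (h * h * z) < 1"
    using norm_qp_less_1[of "k + 2 * x"] x by (simp add: qp_add z_def flip: h(1))
  then have hz: "1 - h * h * z \<noteq> 0"
    by auto
  have z: "z - 1 \<noteq> 0"
    using x by (simp add: z_def)
  have mu: "mu a k x = (1 - z) * mut a k x / (1 - h * h * z)"
    using mu_eq_mut[OF x(1,2)] hz by (simp add: h(1) z_def eq_divide_eq mult.commute)
  have "integrand a k f g x = f' * (h * v + (h - h') / (z - 1) * (v - u)) * mu a k x"
    by (simp only: integrand_def lpeval_Top[OF a g x(3)] h_def h'_def z_def u_def v_def f'_def)
  also have "\<dots> = f' * (((z - 1) * (h * v) + (h - h') * (v - u)) / (z - 1)) * mu a k x"
    using z by (simp add: field_simps)
  also have "\<dots> = f' * ((1 - z) * (h * v) - (h - h') * (v - u)) * mut a k x / (1 - h * h * z)"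
    using z hz unfolding mu by (simp add: divide_simps) (simp add: algebra_simps)
  \<comment> \<open>The coefficient of v is h' - h z, and this equals h' (1 - h^2 z) since h h' =
    1.\<close>
  also have "(1 - z) * (h * v) - (h - h') * (v - u) = h' * v * (1 - h * h * z) + (h - h') * u"
    using h(2) by (simp add: algebra_simps) metis
  also have "f' * (h' * v * (1 - h * h * z) + (h - h') * u) * mut a k x / (1 - h * h * z)
      = h' * f' * v * mut a k x + (h - h') * (f' * u * mut a k x / (1 - h * h * z))"
  proof -
    have "f' * (h' * v * D + (h - h') * u) * m / D = h' * f' * v * m + (h - h') * (f' * u * m / D)"
      if "D \<noteq> 0" for D m
      using that by (simp add: field_simps)
    from this[OF hz] show ?thesis .
  qed
  finally show ?thesis
    by (simp only: h(1) h_def h'_def z_def u_def v_def f'_def)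
qed

text \<open>On every line in the strip the integral is the same multiple of the coefficient
  \<open>c 0\<close>, which plays the part of Cauchy's theorem.\<close>

lemma contour_independence:
  assumes c: "\<And>x. \<bar>Re x\<bar> < (1 + Re k) / 2 \<Longrightarrow> laurent c (qp a x) (\<Phi> x)"
    and I: "((\<lambda>y. \<Phi> (of_real 0 + \<i> * of_real y)) has_integral I) {- (pi * a)..pi * a}"
  shows "((\<lambda>y. \<Phi> (of_real (1 / 4) + \<i> * of_real y)) has_integral I) {- (pi * a)..pi * a}"
proof -
  have "laurent c (qp a (of_real \<sigma> + \<i> * of_real y)) (\<Phi> (of_real \<sigma> + \<i> * of_real y))"
    if "\<bar>\<sigma>\<bar> < (1 + Re k) / 2" for \<sigma> y
    using c[of "of_real \<sigma> + \<i> * of_real y"] that by simp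
  from has_integral_laurent[OF a this] have *:
    "((\<lambda>y. \<Phi> (of_real \<sigma> + \<i> * of_real y)) has_integral (2 * of_real pi * of_real a * c 0)) {- (pi * a)..pi * a}"
    if "\<bar>\<sigma>\<bar> < (1 + Re k) / 2" for \<sigma>
    using that by blast
  have "I = 2 * of_real pi * of_real a * c 0"
    using k by (intro has_integral_unique[OF I] *) auto
  then show ?thesis
    using *[of "1 / 4"] k by simp
qed

lemma laurent_lpeval_mut:
  assumes "fsupp f" "fsupp g"
  shows "\<exists>c. \<forall>x. \<bar>Re x\<bar> < (1 + Re k) / 2 \<longrightarrow> laurent c (qp a x) (lpeval a f x * lpeval a g x * mut a k x)"
proof -
  obtain c where c: "\<And>x. \<bar>Re x\<bar> < (1 + Re k) / 2 \<Longrightarrow> laurent c (qp a x) (mut a k x)"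
    using laurent_mut by blast
  show ?thesis
    by (rule exI, intro allI impI, rule laurent_mult(1)[OF laurent_mult(1)[OF
            laurent_lpeval[OF assms(1)] laurent_lpeval[OF assms(2)]] c]) simp_all
qed

section \<open>Symmetry and adjointness\<close>

lemma form_symmetric:
  assumes f: "fsupp f" and g: "fsupp g"
  shows "form a k f g = form a k g f"
proof -
  let ?h = "qp a (- k / 2)"
  \<comment> \<open>This is the difference of the pole-free terms for (f, g) and (g, f). The terms
    with poles cancel in the difference, so only \<open>\<Phi>\<close> has to be moved to Re x = 0,
    where it is odd in y and integrates to 0.\<close>
  define \<Phi> where "\<Phi> x = lpeval a f x * lpeval a (sop g) x * mut a k x
    + (- 1) * (lpeval a g x * lpeval a (sop f) x * mut a k x)" for x
  obtain c where c: "\<And>x. \<bar>Re x\<bar> < (1 + Re k) / 2 \<Longrightarrow>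
      laurent c (qp a x) (lpeval a f x * lpeval a (sop g) x * mut a k x)"
    using laurent_lpeval_mut[OF f fsupp_sop[OF g]] by blast
  obtain d where d: "\<And>x. \<bar>Re x\<bar> < (1 + Re k) / 2 \<Longrightarrow>
      laurent d (qp a x) (lpeval a g x * lpeval a (sop f) x * mut a k x)"
    using laurent_lpeval_mut[OF g fsupp_sop[OF f]] by blast
  have \<Phi>: "laurent (\<lambda>n. c n + (- 1) * d n) (qp a x) (\<Phi> x)" if "\<bar>Re x\<bar> < (1 + Re k) / 2" for x
    unfolding \<Phi>_def by (intro laurent_add laurent_cmult c d that)
  have odd: "\<Phi> (- x) = - \<Phi> x" for x
    by (simp add: \<Phi>_def lpeval_sop f g mut_minus)
  have "laurent (\<lambda>n. c n + (- 1) * d n) (qp a (of_real 0 + \<i> * of_real y)) (\<Phi> (of_real 0 + \<i> * of_real y))" for y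
    using k by (intro \<Phi>) simp
  from has_integral_laurent[OF a this] obtain I where
    I: "((\<lambda>y. \<Phi> (of_real 0 + \<i> * of_real y)) has_integral I) {- (pi * a)..pi * a}"
    by blast
  have "((\<lambda>y. \<Phi> (of_real 0 + \<i> * of_real (- y))) has_integral I) {- (pi * a)..- (- (pi * a))}"
    using I by (subst has_integral_reflect_real) simp
  then have "((\<lambda>y. - \<Phi> (of_real 0 + \<i> * of_real y)) has_integral I) {- (pi * a)..pi * a}"
    using odd[of "\<i> * of_real _"] by simp
  with has_integral_neg[OF I] have "I = - I"
    by (rule has_integral_unique[rotated])
  then have "I = 0"
    by simp
  with contour_independence[OF \<Phi> I]
  have "((\<lambda>y. \<Phi> (of_real (1 / 4) + \<i> * of_real y)) has_integral 0) {- (pi * a)..pi * a}"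
    by simp
  from has_integral_mult_right[OF this, of ?h]
  have "((\<lambda>y. ?h * \<Phi> (1 / 4 + \<i> * of_real y)) has_integral 0) {- (pi * a)..pi * a}"
    by simp
  moreover have "?h * \<Phi> x = integrand a k f g x - integrand a k g f x" if "Re x = 1 / 4" for x
    using that k qp_double_neq_1[OF a, of x]
    by (subst (1 2) integrand_eq) (simp_all add: f g \<Phi>_def lpeval_sop algebra_simps)
  ultimately have "((\<lambda>y. integrand a k f g (1 / 4 + \<i> * of_real y) - integrand a k g f (1 / 4 + \<i> * of_real y))
      has_integral 0) {- (pi * a)..pi * a}"
    by simp
  moreover have "((\<lambda>y. integrand a k f g (1 / 4 + \<i> * of_real y) - integrand a k g f (1 / 4 + \<i> * of_real y))
      has_integral (2 * of_real pi * of_real a * form a k f g - 2 * of_real pi * of_real a * form a k g f))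
      {- (pi * a)..pi * a}"
    by (intro has_integral_diff form_has_integral f g)
  ultimately have "2 * of_real pi * of_real a * form a k f g - 2 * of_real pi * of_real a * form a k g f = 0"
    by (rule has_integral_unique[rotated])
  then show ?thesis
    using a by simp
qed

text \<open>The integrands for (T f, g) and (T g, f) are both T(f) T(g) times the weight; symmetry
  does the rest.\<close>

lemma form_Top:
  assumes f: "fsupp f" and g: "fsupp g"
  shows "form a k (Top a k f) g = form a k f (Top a k g)"
proof -
  have "form a k (Top a k f) g = form a k (Top a k g) f"
    by (rule form_cong) (auto simp: integrand_def f g fsupp_Top[OF a])
  also have "\<dots> = form a k f (Top a k g)"
    by (rule form_symmetric) (auto simp: f g fsupp_Top[OF a])
  finally show ?thesis .
qed

text \<open>Since (Y f)(x) = (T f)(1/2 - x), the substitution x to 1/2 - x exchanges the integrands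
  for (Y f, g) and (Y g, f). On the line Re x = 1/4 it is just y to -y.\<close>

lemma form_Yop:
  assumes f: "fsupp f" and g: "fsupp g"
  shows "form a k (Yop a k f) g = form a k f (Yop a k g)"
proof -
  have Y: "fsupp (Yop a k f)" "fsupp (Yop a k g)"
    by (simp_all add: f g fsupp_Yop[OF a])
  have eq: "integrand a k (Yop a k f) g (1 / 4 + \<i> * of_real (- y)) = integrand a k (Yop a k g) f (1 / 4 + \<i> * of_real y)" for y
  proof -
    define x where "x = 1 / 4 + \<i> * of_real y"
    have x: "1 / 4 + \<i> * of_real (- y) = 1 / 2 - x"
      by (simp add: x_def)
    show ?thesis
      unfolding x x_def[symmetric] integrand_def mu_reflect
      by (simp add: lpeval_Yop[OF a] f g)
  qed
  have "((\<lambda>y. integrand a k (Yop a k f) g (1 / 4 + \<i> * of_real (- y)))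
      has_integral 2 * of_real pi * of_real a * form a k (Yop a k f) g) {- (pi * a)..- (- (pi * a))}"
    using form_has_integral[OF Y(1) g]
    by (subst has_integral_reflect_real[where f = "\<lambda>y. integrand a k (Yop a k f) g (1 / 4 + \<i> * of_real y)"]) simp
  then have "2 * of_real pi * of_real a * form a k (Yop a k f) g = 2 * of_real pi * of_real a * form a k (Yop a k g) f"
    using form_has_integral[OF Y(2) f] unfolding eq minus_minus by (rule has_integral_unique)
  then have "form a k (Yop a k f) g = form a k (Yop a k g) f"
    using a by simp
  also have "\<dots> = form a k f (Yop a k g)"
    by (intro form_symmetric Y f)
  finally show ?thesis .
qed

text \<open>For X the twist by T is forced by the form: T applied to T^(-1) X T g is X T g, so the
  integrands coincide. The inverses of T and Y are handled by writing g as T T^(-1) g and Y Y^(-1)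
  g.\<close>

lemma form_gen_act:
  assumes f: "fsupp f" and g: "fsupp g"
  shows "form a k (gen_act a k \<gamma> f) g = form a k f (word_act a k (dia_gen \<gamma>) g)"
proof (cases \<gamma>)
  case GT
  then show ?thesis
    using form_Top[OF f g] by (simp add: word_act_def)
next
  case GTi
  have "form a k (Tiop a k f) (Top a k (Tiop a k g)) = form a k (Top a k (Tiop a k f)) (Tiop a k g)"
    by (simp add: form_Top f g fsupp_Tiop[OF a])
  then show ?thesis
    using GTi by (simp add: word_act_def Top_Tiop[OF a] f g)
next
  case GX
  have "form a k (Xop f) g = form a k f (Tiop a k (Xop (Top a k g)))"
    by (rule form_cong)
       (auto simp: integrand_def lpeval_Xop f g Top_Tiop[OF a] fsupp_Xop fsupp_Top[OF a] fsupp_Tiop[OF a])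
  then show ?thesis
    using GX by (simp add: word_act_def)
next
  case GXi
  have "form a k (Xiop f) g = form a k f (Tiop a k (Xiop (Top a k g)))"
    by (rule form_cong)
       (auto simp: integrand_def lpeval_Xiop f g Top_Tiop[OF a] fsupp_Xiop fsupp_Top[OF a] fsupp_Tiop[OF a])
  then show ?thesis
    using GXi by (simp add: word_act_def)
next
  case GY
  then show ?thesis
    using form_Yop[OF f g] by (simp add: word_act_def)
next
  case GYi
  have "form a k (Yiop a k f) (Yop a k (Yiop a k g)) = form a k (Yop a k (Yiop a k f)) (Yiop a k g)"
    by (simp add: form_Yop f g fsupp_Yiop[OF a])
  then show ?thesis
    using GYi by (simp add: word_act_def Yop_Yiop[OF a] f g)
qed

lemma form_word_act:
  assumes f: "fsupp f" and g: "fsupp g"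
  shows "form a k (word_act a k w f) g = form a k f (word_act a k (dia_word w) g)"
  using g
\<comment> \<open>The leftmost generator crosses over first and changes the second argument, hence
  the generalization over \<open>g\<close>. It ends up rightmost there, which is the reversal in
  \<open>dia_word\<close>.\<close>
proof (induction w arbitrary: g)
  case Nil
  then show ?case by (simp add: word_act_def dia_word_def)
next
  case (Cons \<gamma> w)
  have "form a k (word_act a k (\<gamma> # w) f) g = form a k (gen_act a k \<gamma> (word_act a k w f)) g"
    by (simp add: word_act_def)
  also have "\<dots> = form a k (word_act a k w f) (word_act a k (dia_gen \<gamma>) g)"
    by (intro form_gen_act fsupp_word_act[OF a] f Cons.prems)
  also have "\<dots> = form a k f (word_act a k (dia_word w) (word_act a k (dia_gen \<gamma>) g))"
    by (intro Cons.IH fsupp_word_act[OF a] Cons.prems)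
  also have "word_act a k (dia_word w) (word_act a k (dia_gen \<gamma>) g) = word_act a k (dia_word (\<gamma> # w)) g"
    by (simp add: word_act_def dia_word_def)
  finally show ?case .
qed

lemma form_linear_left:
  assumes f: "fsupp f" and f': "fsupp f'" and g: "fsupp g"
  shows "form a k (\<lambda>n. w * f n + f' n) g = w * form a k f g + form a k f' g"
proof -
  have F: "fsupp (\<lambda>n. w * f n + f' n)"
    by (intro fsupp_add fsupp_mult f f')
  let ?c = "2 * of_real pi * of_real a :: complex"
  have "((\<lambda>y. w * integrand a k f g (1 / 4 + \<i> * of_real y) + integrand a k f' g (1 / 4 + \<i> * of_real y))
      has_integral (w * (?c * form a k f g) + ?c * form a k f' g)) {- (pi * a)..pi * a}"
    by (intro has_integral_add has_integral_mult_right form_has_integral f f' g)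
  moreover have "w * integrand a k f g x + integrand a k f' g x = integrand a k (\<lambda>n. w * f n + f' n) g x" for x
    by (simp add: integrand_def lpeval_add lpeval_cmult f f' fsupp_mult algebra_simps)
  ultimately have "w * (?c * form a k f g) + ?c * form a k f' g = ?c * form a k (\<lambda>n. w * f n + f' n) g"
    using has_integral_unique form_has_integral[OF F g] by simp
  then have "?c * form a k (\<lambda>n. w * f n + f' n) g = ?c * (w * form a k f g + form a k f' g)"
    by (simp add: algebra_simps)
  then show ?thesis
    using a by simp
qed

lemma form_hact:
  assumes f: "fsupp f" and g: "fsupp g"
  shows "form a k (hact a k H f) g = form a k f (hact a k (dia H) g)"
proof (induction H)
  case Nil
  have "form a k (\<lambda>n. 0) g = form a k (\<lambda>n. 0) f"
    by (rule form_cong) (auto simp: fsupp_0 f g integrand_def lpeval_def)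
  then show ?case
    using form_symmetric[OF fsupp_0 f] by (simp add: hact_Nil dia_def)
next
  case (Cons p H)
  obtain w \<gamma> where p: "p = (w, \<gamma>)"
    by (cases p)
  have "form a k (hact a k (p # H) f) g = w * form a k (word_act a k \<gamma> f) g + form a k (hact a k H f) g"
    unfolding p hact_Cons by (intro form_linear_left fsupp_word_act[OF a] fsupp_hact[OF a] f g)
  \<comment> \<open>Symmetry moves the sum into the first slot, so that linearity on the left
    suffices on both sides.\<close>
  also have "\<dots> = w * form a k (word_act a k (dia_word \<gamma>) g) f + form a k (hact a k (dia H) g) f"
    by (simp add: form_word_act f g Cons.IH form_symmetric[OF f] fsupp_word_act[OF a] fsupp_hact[OF a])
  also have "\<dots> = form a k (hact a k (dia (p # H)) g) f"
    unfolding p dia_def list.map case_prod_conv hact_Cons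
    by (intro form_linear_left[symmetric] fsupp_word_act[OF a] fsupp_hact[OF a] f g)
  also have "\<dots> = form a k f (hact a k (dia (p # H)) g)"
    by (intro form_symmetric fsupp_hact[OF a] f g)
  finally show ?case .
qed

end

subsection \<open>Positivity\<close>

lemma Re_of_real_mult: "Re (of_real c * z) = c * Re z"
  by simp

lemma has_sum_diff:
  fixes u v :: "'a \<Rightarrow> complex"
  assumes "(u has_sum s) A" "(v has_sum t) A"
  shows "((\<lambda>x. u x - v x) has_sum (s - t)) A"
  using has_sum_add[OF assms(1) has_sum_uminusI[OF assms(2)]] by simp

lemma has_sum_even_geometric:
  fixes w :: complex
  assumes "norm w < 1"
  shows "((\<lambda>n::int. if 0 \<le> n \<and> even n then w powi n else 0) has_sum 1 / (1 - w ^ 2)) UNIV"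
proof -
  have "norm (w ^ 2) < 1"
    using assms by (simp add: norm_power power_less_one_iff)
  then have "((\<lambda>n. (w ^ 2) ^ n) has_sum 1 / (1 - w ^ 2)) UNIV"
    by (intro norm_summable_imp_has_sum geometric_sums) (simp add: norm_power summable_geometric)
  also have "?this \<longleftrightarrow> ((\<lambda>n::int. if 0 \<le> n \<and> even n then w powi n else 0) has_sum 1 / (1 - w ^ 2)) {n. 0 \<le> n \<and> even n}"
    by (rule has_sum_reindex_bij_witness[of _ "\<lambda>n. nat (n div 2)" "\<lambda>n. 2 * int n"])
       (auto simp: power_int_def nat_mult_distrib simp flip: power_mult)
  also have "\<dots> \<longleftrightarrow> ((\<lambda>n::int. if 0 \<le> n \<and> even n then w powi n else 0) has_sum 1 / (1 - w ^ 2)) UNIV"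
    by (rule has_sum_cong_neutral) auto
  finally show ?thesis .
qed

text \<open>\<open>geom_in h\<close> and \<open>geom_out h\<close> are the Laurent coefficients of \<open>1 / (1 - (h X)\<^sup>2)\<close>
  inside and outside the circle through its poles.\<close>

definition geom_in :: "complex \<Rightarrow> int \<Rightarrow> complex" where
  "geom_in h n = (if 0 \<le> n \<and> even n then h powi n else 0)"

definition geom_out :: "complex \<Rightarrow> int \<Rightarrow> complex" where
  "geom_out h n = (if n = 0 then 1 else 0) - (if n \<le> 0 \<and> even n then h powi n else 0)"

lemma laurent_geom_in:
  assumes "norm (h * X) < 1"
  shows "laurent (geom_in h) X (1 / (1 - (h * X) ^ 2))"
  unfolding laurent_def
  by (rule has_sum_cong[THEN iffD1, OF _ has_sum_even_geometric[OF assms]])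
     (simp add: geom_in_def power_int_mult_distrib)

text \<open>Outside the circle, 1 / (1 - w^2) = 1 - 1 / (1 - w^(-2)) is expanded in negative powers.
  The leading 1 cancels the constant term of the series.\<close>

lemma laurent_geom_out:
  assumes "norm (h * X) > 1"
  shows "laurent (geom_out h) X (1 / (1 - (h * X) ^ 2))"
proof -
  have nz: "h * X \<noteq> 0"
    using assms by auto
  have "norm ((h * X) ^ 2) > 1"
    using assms by (simp add: norm_power one_less_power)
  then have nz2: "(h * X) ^ 2 \<noteq> 1" "(h * X) ^ 2 \<noteq> 0"
    using nz by (metis norm_one order_less_irrefl, simp)
  have "norm (inverse (h * X)) < 1"
    using less_imp_inverse_less[OF assms zero_less_one] by (simp only: norm_inverse inverse_1)
  note has_sum_even_geometric[OF this]
  also have "((\<lambda>n::int. if 0 \<le> n \<and> even n then inverse (h * X) powi n else 0) has_sum 1 / (1 - inverse (h * X) ^ 2)) UNIV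
    \<longleftrightarrow> ((\<lambda>n::int. if n \<le> 0 \<and> even n then (h * X) powi n else 0) has_sum 1 / (1 - inverse (h * X) ^ 2)) UNIV"
    by (rule has_sum_reindex_bij_witness[of _ uminus uminus])
       (auto simp: power_int_minus power_int_inverse simp del: inverse_mult_distrib)
  finally have even_sum: "((\<lambda>n::int. if n \<le> 0 \<and> even n then (h * X) powi n else 0) has_sum
      1 / (1 - inverse (h * X) ^ 2)) UNIV" .
  have "((\<lambda>n::int. if n = 0 then 1 else 0) has_sum (1::complex)) UNIV"
    by (rule has_sum_finite_neutralI[of "{0}"]) auto
  from has_sum_diff[OF this even_sum] have "((\<lambda>n::int. (if n = 0 then 1 else 0) - (if n \<le> 0 \<and> even n then (h * X) powi n else 0))
      has_sum (1 - 1 / (1 - inverse (h * X) ^ 2))) UNIV"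
    .
  moreover have "1 - 1 / (1 - inverse (h * X) ^ 2) = 1 / (1 - (h * X) ^ 2)"
  proof -
    have "1 - 1 / (1 - inverse w) = 1 / (1 - w)" if "w \<noteq> 0" "w \<noteq> 1" for w :: complex
      using that by (simp add: divide_simps)
    then show ?thesis
      unfolding power_inverse using nz2 by blast
  qed
  ultimately have *: "((\<lambda>n::int. (if n = 0 then 1 else 0) - (if n \<le> 0 \<and> even n then (h * X) powi n else 0))
      has_sum (1 / (1 - (h * X) ^ 2))) UNIV"
    by simp
  show ?thesis
    unfolding laurent_def
    by (rule has_sum_cong[THEN iffD1, OF _ *])
       (auto simp: geom_out_def power_int_mult_distrib algebra_simps)
qed

text \<open>The residues at the two poles \<open>\<plusminus> 1 / h\<close> picked up between the two annuli.\<close>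

lemma geom_in_eq_geom_out_plus_residues:
  assumes X: "laurent c X u" "norm (h * X) < 1" "X \<noteq> 0"
    and X': "laurent c X' u'" "norm (h * X') > 1"
    and v: "laurent c (inverse h) v" "laurent c (- inverse h) v'"
  shows "(\<Sum>\<^sub>\<infinity>m. c m * geom_in h (0 - m)) = (\<Sum>\<^sub>\<infinity>m. c m * geom_out h (0 - m)) + (v + v') / 2"
proof -
  have nz: "X' \<noteq> 0" "h \<noteq> 0"
    using X'(2) by auto
  have "((\<lambda>m. c m * geom_in h (0 - m)) has_sum (\<Sum>\<^sub>\<infinity>m. c m * geom_in h (0 - m))) UNIV"
    using laurent_mult(2)[OF X(1) laurent_geom_in[OF X(2)] X(3)] by (rule has_sum_infsum)
  moreover have "((\<lambda>m. c m * geom_out h (0 - m)) has_sum (\<Sum>\<^sub>\<infinity>m. c m * geom_out h (0 - m))) UNIV"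
    using laurent_mult(2)[OF X'(1) laurent_geom_out[OF X'(2)] nz(1)] by (rule has_sum_infsum)
  ultimately have "((\<lambda>m. c m * geom_in h (0 - m) - c m * geom_out h (0 - m)) has_sum
      (\<Sum>\<^sub>\<infinity>m. c m * geom_in h (0 - m)) - (\<Sum>\<^sub>\<infinity>m. c m * geom_out h (0 - m))) UNIV"
    by (rule has_sum_diff)
  \<comment> \<open>The difference of the two expansions has coefficient h^n at every even n,
    including n = 0. Restriction to even indices is the average over the two points 1/h and
    -1/h.\<close>
  moreover have "c m * geom_in h (0 - m) - c m * geom_out h (0 - m)
      = (c m * inverse h powi m + c m * (- inverse h) powi m) / 2" for m
    using nz by (auto simp: geom_in_def geom_out_def power_int_minus power_int_inverse power_int_minus_left)
  ultimately have "((\<lambda>m. (c m * inverse h powi m + c m * (- inverse h) powi m) / 2) has_sum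
      (\<Sum>\<^sub>\<infinity>m. c m * geom_in h (0 - m)) - (\<Sum>\<^sub>\<infinity>m. c m * geom_out h (0 - m))) UNIV"
    by (simp only:)
  moreover have "((\<lambda>m. (c m * inverse h powi m + c m * (- inverse h) powi m) / 2) has_sum (v + v') / 2) UNIV"
    using v unfolding laurent_def divide_inverse by (intro has_sum_cmult_left has_sum_add)
  ultimately have "(\<Sum>\<^sub>\<infinity>m. c m * geom_in h (0 - m)) - (\<Sum>\<^sub>\<infinity>m. c m * geom_out h (0 - m)) = (v + v') / 2"
    by (rule has_sum_unique)
  then show ?thesis
    by (simp only: diff_eq_eq add.commute)
qed

text \<open>The squares differ by 2 T (1 - Re z), which is positive unless z = 1.\<close>

lemma norm_one_minus_scaled:
  fixes z :: complex
  assumes z: "norm z = 1" "z \<noteq> 1" and T: "0 < T"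
  shows "\<bar>T - 1\<bar> < norm (1 - of_real T * z)"
proof -
  have z1: "Re z ^ 2 + Im z ^ 2 = 1"
    using z(1) by (metis cmod_power2 one_power2)
  have "Re z \<noteq> 1"
    using z1 z(2) by (auto simp: complex_eq_iff)
  then have "Re z < 1"
    using complex_Re_le_cmod[of z] z(1) by linarith
  have "norm (1 - of_real T * z) ^ 2 = 1 - 2 * T * Re z + T ^ 2 * (Re z ^ 2 + Im z ^ 2)"
    unfolding cmod_power2 by (simp add: power2_eq_square algebra_simps)
  also have "\<dots> > 1 - 2 * T * 1 + T ^ 2 * 1"
    using \<open>Re z < 1\<close> T z1 by simp
  finally have "\<bar>T - 1\<bar> ^ 2 < norm (1 - of_real T * z) ^ 2"
    by (simp add: power2_eq_square algebra_simps)
  then show ?thesis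
    by (rule power_less_imp_less_base) simp
qed

lemma
  fixes z w :: complex
  assumes z: "norm z = 1" and T: "0 < T"
  shows integrand_on_circle_nonneg:
      "0 \<le> norm w ^ 2 + Re (of_real (T - 1) * (w * w / (1 - of_real T * z)))"
    and integrand_on_circle_pos:
      "z \<noteq> 1 \<Longrightarrow> w \<noteq> 0 \<Longrightarrow> 0 < norm w ^ 2 + Re (of_real (T - 1) * (w * w / (1 - of_real T * z)))"
proof -
  \<comment> \<open>The second summand is bounded in modulus by |w|^2 times this ratio. At T = z = 1
    both the ratio and the quotient in the claim are 0 by the convention on division by
    zero.\<close>
  define \<rho> where "\<rho> = \<bar>T - 1\<bar> / norm (1 - of_real T * z)"
  have "norm (of_real (T - 1) * (w * w / (1 - of_real T * z))) = norm w ^ 2 * \<rho>"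
    by (simp add: \<rho>_def norm_mult norm_divide power2_eq_square del: of_real_diff)
  then have *: "Re (of_real (T - 1) * (w * w / (1 - of_real T * z))) \<ge> - (norm w ^ 2 * \<rho>)"
    using abs_Re_le_cmod[of "of_real (T - 1) * (w * w / (1 - of_real T * z))"] by linarith
  have "\<bar>T - 1\<bar> \<le> norm (1 - of_real T * z)"
    using norm_triangle_ineq3[of 1 "of_real T * z"] z T by (simp add: norm_mult abs_minus_commute)
  then have "\<rho> \<le> 1"
    unfolding \<rho>_def by (simp add: divide_le_eq_1)
  then have "norm w ^ 2 * \<rho> \<le> norm w ^ 2 * 1"
    by (intro mult_left_mono) auto
  with * show "0 \<le> norm w ^ 2 + Re (of_real (T - 1) * (w * w / (1 - of_real T * z)))"
    by linarith
  assume "z \<noteq> 1" "w \<noteq> 0"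
  then have "\<rho> < 1"
    using norm_one_minus_scaled[OF z _ T] unfolding \<rho>_def by (simp add: divide_less_eq_1)
  then have "norm w ^ 2 * \<rho> < norm w ^ 2 * 1"
    using \<open>w \<noteq> 0\<close> by (intro mult_strict_left_mono) auto
  with * show "0 < norm w ^ 2 + Re (of_real (T - 1) * (w * w / (1 - of_real T * z)))"
    by linarith
qed

text \<open>All factors of the product are nonnegative, and the nonnegative reals are closed under
  limits.\<close>

lemma qbin_nonneg_real:
  assumes q: "0 \<le> q" "q < 1" and s: "0 \<le> s" "s \<le> 1" and T: "0 \<le> T" "T * s < 1"
  shows "qbin (of_real q) (of_real T) (of_real s) \<in> \<real>\<^sub>\<ge>\<^sub>0"
proof (rule closed_sequentially[OF closed_nonneg_Reals_complex])
  show "(\<lambda>n. \<Prod>i\<le>n. (1 - complex_of_real q ^ i * of_real s) / (1 - of_real q ^ i * of_real T * of_real s))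
      \<longlonglongrightarrow> qbin (of_real q) (of_real T) (of_real s)"
    using q s T by (intro qbin_prod_tendsto) (simp_all add: norm_mult)
  fix n
  have "0 \<le> (\<Prod>i\<le>n. (1 - q ^ i * s) / (1 - q ^ i * T * s))"
  proof (intro prod_nonneg divide_nonneg_nonneg)
    fix i
    have qi: "0 \<le> q ^ i" "q ^ i \<le> 1"
      using q by (auto intro: power_le_one)
    show "0 \<le> 1 - q ^ i * s"
      using qi s by (simp add: mult_le_one)
    have "q ^ i * (T * s) \<le> 1 * (T * s)"
      using qi s T by (intro mult_right_mono) auto
    then show "0 \<le> 1 - q ^ i * T * s"
      using T by (simp add: mult.assoc)
  qed
  then have "complex_of_real (\<Prod>i\<le>n. (1 - q ^ i * s) / (1 - q ^ i * T * s)) \<in> \<real>\<^sub>\<ge>\<^sub>0"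
    by (simp only: nonneg_Reals_of_real_iff)
  then show "(\<Prod>i\<le>n. (1 - complex_of_real q ^ i * of_real s) / (1 - of_real q ^ i * of_real T * of_real s)) \<in> \<real>\<^sub>\<ge>\<^sub>0"
    by (simp only: of_real_prod of_real_divide of_real_diff of_real_mult of_real_power of_real_1)
qed

lemma cnj_qbin:
  assumes q: "norm (of_real q :: complex) < 1" and z: "norm (of_real t * z) < 1"
  shows "cnj (qbin (of_real q) (of_real t) z) = qbin (of_real q) (of_real t) (cnj z)"
proof (rule LIMSEQ_unique)
  let ?p = "\<lambda>z n. \<Prod>i\<le>n. (1 - complex_of_real q ^ i * z) / (1 - of_real q ^ i * of_real t * z)"
  have "(\<lambda>n. cnj (?p z n)) \<longlonglongrightarrow> cnj (qbin (of_real q) (of_real t) z)"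
    by (intro tendsto_cnj qbin_prod_tendsto q z)
  then show "?p (cnj z) \<longlonglongrightarrow> cnj (qbin (of_real q) (of_real t) z)"
    by simp
  show "?p (cnj z) \<longlonglongrightarrow> qbin (of_real q) (of_real t) (cnj z)"
    using z by (intro qbin_prod_tendsto q) (simp add: norm_mult)
qed

lemma cnj_lpeval:
  assumes "\<And>n. f n \<in> \<real>"
  shows "cnj (lpeval a f x) = lpeval a f (cnj x)"
  using assms by (simp add: lpeval_def cnj_qp Reals_cnj_iff)

lemma lpeval_real:
  assumes "\<And>n. f n \<in> \<real>" "qp a x \<in> \<real>"
  shows "lpeval a f x \<in> \<real>"
  unfolding lpeval_def qp_of_int_mult using assms
  by (intro sum_in_Reals Reals_mult) (auto elim!: Reals_cases simp flip: of_real_power_int)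

lemma holomorphic_lpeval: "lpeval a f holomorphic_on S"
  unfolding lpeval_def[abs_def] by (intro holomorphic_intros)

section \<open>Real k and Laurent polynomials with real coefficients\<close>

context
  fixes a r :: real and f :: "int \<Rightarrow> complex"
  assumes a: "0 < a" and r: "- 1 / 2 < r" and f: "fsupp f" and f_real: "\<And>n. f n \<in> \<real>"
begin

abbreviation (input) sqrt_t :: real where "sqrt_t \<equiv> exp (- (r / 2) / a)"
abbreviation (input) real_t :: real where "real_t \<equiv> exp (- r / a)"

lemma Re_of_real_gt: "- 1 / 2 < Re (complex_of_real r)"
  using r by simp

lemma qp_half: "qp a (complex_of_real r / 2) = of_real sqrt_t" "qp a (- complex_of_real r / 2) = of_real (inverse sqrt_t)"
  using qp_of_real[of a "r / 2"] qp_of_real[of a "- (r / 2)"] by (simp_all add: exp_minus)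

lemma real_t_eq: "real_t = sqrt_t * sqrt_t"
  by (simp flip: exp_add)

lemma cnj_mut:
  assumes x: "\<bar>Re x\<bar> < (1 + r) / 2"
  shows "cnj (mut a (of_real r) x) = mut a (of_real r) (cnj x)"
proof -
  have "of_real real_t * (qp a 1 * qp a y ^ 2) = qp a (of_real r + 1 + 2 * y)" for y
    by (simp add: qp_add qp_double qp_of_real)
  then have "norm (of_real real_t * (qp a 1 * qp a y ^ 2)) < 1" if "\<bar>Re y\<bar> < (1 + r) / 2" for y
    using norm_qp_less_1[OF a Re_of_real_gt, of "of_real r + 1 + 2 * y"] that by (simp add: abs_if split: if_splits)
  from cnj_qbin[OF _ this] norm_qp_1[OF a Re_of_real_gt] x show ?thesis
    using qp_of_real[of a 1] qp_of_real[of a r] by (simp add: mut_def cnj_qp)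
qed

lemma form_real: "Im (form a (of_real r) f f) = 0"
proof -
  let ?F = "\<lambda>y. integrand a (of_real r) f f (1 / 4 + \<i> * of_real y)"
  let ?c = "2 * of_real pi * of_real a :: complex"
  have sym: "cnj (?F y) = ?F (- y)" for y
  proof -
    define x where "x = 1 / 4 + \<i> * of_real y"
    have x: "Re x = 1 / 4" "Re (cnj x) = 1 / 4" "1 / 4 + \<i> * of_real (- y) = cnj x"
      by (simp_all add: x_def complex_eq_iff)
    \<comment> \<open>In this form every ingredient is known to commute with conjugation, which on
      the line is y to -y. The integral therefore equals its own conjugate.\<close>
    have eq: "integrand a (of_real r) f f x = qp a (- of_real r / 2) * lpeval a f x * lpeval a f (- x) * mut a (of_real r) x
      + (qp a (of_real r / 2) - qp a (- of_real r / 2)) * (lpeval a f x * lpeval a f x * mut a (of_real r) x / (1 - qp a (of_real r) * qp a (2 * x)))"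
      if "Re x = 1 / 4" for x
      by (rule integrand_eq[OF a Re_of_real_gt f f]) (use r that qp_double_neq_1[OF a, of x] in auto)
    have "cnj (integrand a (of_real r) f f x) = integrand a (of_real r) f f (cnj x)"
      unfolding eq[OF x(1)] eq[OF x(2)] using cnj_mut[of x] r x(1)
      by (simp add: cnj_lpeval[OF f_real] cnj_qp)
    then show ?thesis
      unfolding x(3) by (simp add: x_def)
  qed
  have I: "(?F has_integral ?c * form a (of_real r) f f) {- (pi * a)..pi * a}"
    by (rule form_has_integral[OF a Re_of_real_gt f f])
  then have "((\<lambda>y. ?F (- y)) has_integral ?c * form a (of_real r) f f) {- (pi * a)..- (- (pi * a))}"
    by (subst has_integral_reflect_real) simp
  then have "((cnj \<circ> ?F) has_integral ?c * form a (of_real r) f f) {- (pi * a)..pi * a}"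
    by (simp add: o_def sym)
  moreover have "((cnj \<circ> ?F) has_integral cnj (?c * form a (of_real r) f f)) {- (pi * a)..pi * a}"
    using I by (simp only: has_integral_cnj)
  ultimately have "cnj (?c * form a (of_real r) f f) = ?c * form a (of_real r) f f"
    using has_integral_unique by blast
  then have "cnj (form a (of_real r) f f) = form a (of_real r) f f"
    using a by simp
  then show ?thesis
    by (simp add: complex_eq_iff)
qed

text \<open>At t X^2 = 1 the two arguments become q^(1-r) and q^(1+r). Multiplied by t they are q
  and q^(1+2r), and the latter is below 1 exactly because r > -1/2.\<close>

lemma mut_at_pole_nonneg:
  assumes "r < 0" "qp a x ^ 2 = qp a (- of_real r)"
  shows "mut a (of_real r) x \<in> \<real>\<^sub>\<ge>\<^sub>0"
proof -
  have x': "qp a (- x) ^ 2 = qp a (of_real r)"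
    using assms(2) by (simp add: qp_minus power_inverse)
  have "qp a 1 * qp a x ^ 2 = qp a (of_real (1 - r))" "qp a 1 * qp a (- x) ^ 2 = qp a (of_real (1 + r))"
    unfolding assms(2) x' qp_add[symmetric] by simp_all
  moreover have "qp a 1 = of_real (exp (- 1 / a))"
    using qp_of_real[of a 1] by simp
  ultimately have eq: "qp a 1 * qp a x ^ 2 = of_real (exp (- (1 - r) / a))"
    "qp a 1 * qp a (- x) ^ 2 = of_real (exp (- (1 + r) / a))"
    "qp a 1 = of_real (exp (- 1 / a))" "qp a (of_real r) = of_real real_t"
    by (simp_all only: qp_of_real)
  show ?thesis
    unfolding mut_def eq(1,2) unfolding eq(3,4)
    by (intro nonneg_Reals_mult_I qbin_nonneg_real)
       (use a r assms(1) in \<open>simp_all add: divide_simps flip: exp_add add_divide_distrib\<close>)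
qed

lemma contour_shift:
  defines "G \<equiv> \<lambda>x. of_real (sqrt_t - inverse sqrt_t) *
    (lpeval a f x * lpeval a f x * mut a (of_real r) x / (1 - (of_real sqrt_t * qp a x) ^ 2))"
  shows "\<exists>I \<nu>. ((\<lambda>y. G (of_real 0 + \<i> * of_real y)) has_integral I) {- (pi * a)..pi * a} \<and>
    ((\<lambda>y. G (of_real (1 / 4) + \<i> * of_real y)) has_integral (I + of_real \<nu>)) {- (pi * a)..pi * a} \<and> 0 \<le> \<nu>"
proof -
  let ?w = "of_real (sqrt_t - inverse sqrt_t) :: complex" and ?h = "of_real sqrt_t :: complex"
  define F where "F x = lpeval a f x * lpeval a f x * mut a (of_real r) x" for x
  obtain c where "\<And>x. \<bar>Re x\<bar> < (1 + r) / 2 \<Longrightarrow> laurent c (qp a x) (F x)"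
    using laurent_lpeval_mut[OF a Re_of_real_gt f f] unfolding F_def by auto
  then have c: "laurent c (qp a x) (F x)" if "\<bar>Re x\<bar> < (1 + r) / 2" for x
    using that by blast
  have norm_hX: "norm (?h * qp a (of_real \<sigma> + \<i> * of_real y)) = exp (- (r / 2 + \<sigma>) / a)" for \<sigma> y
    by (simp add: norm_mult norm_qp diff_divide_distrib flip: exp_add)
  have inner: "((\<lambda>y. G (of_real \<sigma> + \<i> * of_real y)) has_integral
      (?w * (2 * of_real pi * of_real a * (\<Sum>\<^sub>\<infinity>m. c m * geom_in ?h (0 - m))))) {- (pi * a)..pi * a}"
    if \<sigma>: "\<bar>\<sigma>\<bar> < (1 + r) / 2" "0 < r / 2 + \<sigma>" for \<sigma>
  proof -
    have "norm (?h * qp a (of_real \<sigma> + \<i> * of_real y)) < 1" for y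
      unfolding norm_hX using \<sigma> a divide_neg_pos[of "- (r / 2 + \<sigma>)" a] by simp
    then have "laurent (\<lambda>n. \<Sum>\<^sub>\<infinity>m. c m * geom_in ?h (n - m)) (qp a (of_real \<sigma> + \<i> * of_real y))
        (F (of_real \<sigma> + \<i> * of_real y) * (1 / (1 - (?h * qp a (of_real \<sigma> + \<i> * of_real y)) ^ 2)))" for y
      by (intro laurent_mult(1) c laurent_geom_in) (use \<sigma> in auto)
    from has_integral_mult_right[OF has_integral_laurent[OF a this], of ?w] show ?thesis
      by (simp add: G_def F_def)
  qed
  \<comment> \<open>The poles lie on Re x = -r/2. For r > 0 this is left of both lines; for r < 0 it
    is strictly between them, as -r/2 < 1/4; for r = 0 the prefactor vanishes.\<close>
  consider "r = 0" | "r > 0" | "r < 0"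
    by linarith
  then show ?thesis
  proof cases
    case 1
    then have "G x = 0" for x
      by (simp add: G_def)
    then show ?thesis
      by (intro exI[of _ 0]) simp
  next
    case 2
    with inner[of 0] inner[of "1 / 4"] r show ?thesis
      by (intro exI[of _ "?w * (2 * of_real pi * of_real a * (\<Sum>\<^sub>\<infinity>m. c m * geom_in ?h (0 - m)))"] exI[of _ 0]) simp
  next
    case 3
    have outer: "((\<lambda>y. G (of_real 0 + \<i> * of_real y)) has_integral
      (?w * (2 * of_real pi * of_real a * (\<Sum>\<^sub>\<infinity>m. c m * geom_out ?h (0 - m))))) {- (pi * a)..pi * a}"
    proof -
      have "norm (?h * qp a (of_real 0 + \<i> * of_real y)) > 1" for y
        unfolding norm_hX using 3 a by (simp add: divide_less_0_iff)
      then have "laurent (\<lambda>n. \<Sum>\<^sub>\<infinity>m. c m * geom_out ?h (n - m)) (qp a (of_real 0 + \<i> * of_real y))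
          (F (of_real 0 + \<i> * of_real y) * (1 / (1 - (?h * qp a (of_real 0 + \<i> * of_real y)) ^ 2)))" for y
        by (intro laurent_mult(1) c laurent_geom_out) (use r in auto)
      from has_integral_mult_right[OF has_integral_laurent[OF a this], of ?w] show ?thesis
        by (simp add: G_def F_def)
    qed
    define x0 where "x0 = - complex_of_real r / 2"
    \<comment> \<open>The two poles in one period are at X = t^(-1/2) and X = -t^(-1/2); a shift by
      pi a i changes the sign of X.\<close>
    define x1 where "x1 = x0 + of_real pi * of_real a * \<i>"
    have X0: "qp a x0 = inverse ?h"
      using qp_half by (simp add: x0_def)
    have "qp a (of_real pi * of_real a * \<i>) = - 1"
      using a by (simp add: qp_def exp_minus)
    then have X1: "qp a x1 = - inverse ?h"
      unfolding x1_def qp_add X0 by simp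
    have Re: "\<bar>Re x0\<bar> < (1 + r) / 2" "\<bar>Re x1\<bar> < (1 + r) / 2"
      using 3 r by (simp_all add: x0_def x1_def)
    have n: "norm (?h * qp a (of_real (1 / 4))) < 1" "norm (?h * qp a (of_real 0)) > 1"
      using norm_hX[of "1 / 4" 0] norm_hX[of 0 0] divide_neg_pos[of "- (r / 2 + 1 / 4)" a] 3 r a
      by (simp_all add: divide_less_0_iff)
    have l: "laurent c (qp a (of_real (1 / 4))) (F (of_real (1 / 4)))" "laurent c (qp a (of_real 0)) (F (of_real 0))"
      using r by (intro c; simp)+
    have res: "(\<Sum>\<^sub>\<infinity>m. c m * geom_in ?h (0 - m)) = (\<Sum>\<^sub>\<infinity>m. c m * geom_out ?h (0 - m)) + (F x0 + F x1) / 2"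
      by (rule geom_in_eq_geom_out_plus_residues[OF l(1) n(1) qp_nonzero l(2) n(2)
            c[OF Re(1), unfolded X0] c[OF Re(2), unfolded X1]])
    have sq: "inverse ?h ^ 2 = qp a (- of_real r)"
      using real_t_eq qp_of_real[of a r] by (simp add: qp_minus power2_eq_square)
    have "F x \<in> \<real>\<^sub>\<ge>\<^sub>0" if pole: "qp a x \<in> \<real>" "qp a x ^ 2 = qp a (- of_real r)" for x
    proof -
      obtain v where v: "lpeval a f x = of_real v"
        using lpeval_real[of f a x, OF f_real pole(1)] by (auto elim: Reals_cases)
      then have "lpeval a f x * lpeval a f x = of_real (v * v)"
        by simp
      also have "\<dots> \<in> \<real>\<^sub>\<ge>\<^sub>0"
        unfolding nonneg_Reals_of_real_iff by simp
      finally show ?thesis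
        unfolding F_def by (rule nonneg_Reals_mult_I[OF _ mut_at_pole_nonneg[OF 3 pole(2)]])
    qed
    from this[of x0] this[of x1] have "F x0 \<in> \<real>\<^sub>\<ge>\<^sub>0" "F x1 \<in> \<real>\<^sub>\<ge>\<^sub>0"
      using sq by (simp_all add: X0 X1)
    then obtain v0 v1 where v: "F x0 = of_real v0" "F x1 = of_real v1" "0 \<le> v0" "0 \<le> v1"
      by (metis nonneg_Reals_cases)
    have "1 < sqrt_t"
      using 3 a by (simp add: divide_less_0_iff)
    then have w: "0 \<le> sqrt_t - inverse sqrt_t"
      using inverse_le_1_iff[of sqrt_t] by linarith
    let ?\<nu> = "(sqrt_t - inverse sqrt_t) * (2 * pi * a * ((v0 + v1) / 2))"
    have "?w * (2 * of_real pi * of_real a * (\<Sum>\<^sub>\<infinity>m. c m * geom_in ?h (0 - m)))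
        = ?w * (2 * of_real pi * of_real a * (\<Sum>\<^sub>\<infinity>m. c m * geom_out ?h (0 - m))) + of_real ?\<nu>"
      unfolding res v by (simp add: algebra_simps)
    moreover have "0 \<le> ?\<nu>"
      using w v a by (intro mult_nonneg_nonneg) auto
    ultimately show ?thesis
      using outer inner[of "1 / 4"] 3 r by (intro exI[of _ ?\<nu>] exI conjI) auto
  qed
qed

lemma continuous_on_mut: "continuous_on UNIV (\<lambda>y. mut a (of_real r) (\<i> * of_real y))"
proof -
  let ?q = "qp a 1" and ?t = "qp a (of_real r)"
  \<comment> \<open>The arguments of the two series have modulus q, and the disc |t z| < 1 has
    radius q^(-r). \<open>K\<close> is the geometric mean of these, with r > -1 ensuring that it is
    larger than q.\<close>
  define K where "K = qp a (of_real ((1 - r) / 2))"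
  have "?t * K = qp a (of_real r + of_real ((1 - r) / 2))"
    by (simp only: K_def qp_add)
  then have "norm (?t * K) < 1"
    using norm_qp_less_1[OF a Re_of_real_gt, of "of_real r + of_real ((1 - r) / 2)"] r by (simp add: field_simps)
  then have "summable (\<lambda>n. qbin_coeff ?q ?t n * K ^ n)"
    by (intro summable_norm_cancel[OF summable_qbin] norm_qp_1[OF a Re_of_real_gt])
  moreover have "(1 - r) / 2 / a < 1 / a"
    using a r by (intro divide_strict_right_mono) auto
  then have "norm ?q < norm K"
    by (simp add: K_def norm_qp)
  ultimately have cont: "continuous_on UNIV (\<lambda>y. qbin ?q ?t (g y))"
    if "continuous_on UNIV g" "\<And>y. norm (g y) = norm ?q" for g :: "real \<Rightarrow> complex"
    unfolding qbin_def continuous_on_eq_continuous_at[OF open_UNIV]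
    using that by (auto simp: continuous_on_eq_continuous_at intro!: isCont_powser'[where K = K])
  show ?thesis
    unfolding mut_def
    by (intro continuous_intros cont) (auto simp: norm_mult norm_power norm_qp)
qed

text \<open>For real k and |X| = 1 the two factors are complex conjugates of each other, so the
  product is a squared modulus. It is nonzero since the argument has modulus q < 1.\<close>

lemma mut_on_circle_pos: "\<exists>m>0. mut a (of_real r) (\<i> * of_real y) = of_real m"
proof -
  let ?z = "qp a 1 * qp a (\<i> * of_real y) ^ 2"
  let ?A = "qbin (qp a 1) (qp a (of_real r)) ?z"
  have "qp a (of_real r) * ?z = qp a (of_real r + 1 + 2 * (\<i> * of_real y))"
    by (simp add: qp_add qp_double)
  then have tz: "norm (qp a (of_real r) * ?z) < 1"
    using norm_qp_less_1[OF a Re_of_real_gt, of "of_real r + 1 + 2 * (\<i> * of_real y)"] r by simp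
  have z: "norm ?z < 1"
    using norm_qp_1[OF a Re_of_real_gt] by (simp add: norm_mult norm_power norm_qp)
  have "cnj ?z = qp a 1 * qp a (- (\<i> * of_real y)) ^ 2"
    by (simp add: cnj_qp)
  moreover have "cnj ?A = qbin (qp a 1) (qp a (of_real r)) (cnj ?z)"
    using cnj_qbin[of "exp (- 1 / a)" real_t ?z] tz norm_qp_1[OF a Re_of_real_gt] qp_of_real[of a 1] qp_of_real[of a r] by simp
  ultimately have "mut a (of_real r) (\<i> * of_real y) = ?A * cnj ?A"
    by (simp add: mut_def)
  also have "\<dots> = of_real (norm ?A ^ 2)"
    by (rule complex_norm_square[symmetric])
  finally show ?thesis
    using qbin_nonzero[OF norm_qp_1[OF a Re_of_real_gt] tz z] by (intro exI[of _ "norm ?A ^ 2"]) simp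
qed

lemma form_pos:
  assumes f_nz: "f \<noteq> (\<lambda>_. 0)"
  shows "0 < Re (form a (of_real r) f f)"
proof -
  let ?h = "of_real sqrt_t :: complex"
  \<comment> \<open>\<open>P\<close> and \<open>G\<close> are the two terms of
    \<open>integrand_eq\<close> with g = f. \<open>P\<close> has no poles in the strip and moves
    freely to Re x = 0, while \<open>G\<close> contributes the nonnegative amount
    \<open>\<nu>\<close>.\<close>
  define G where "G x = of_real (sqrt_t - inverse sqrt_t) *
    (lpeval a f x * lpeval a f x * mut a (of_real r) x / (1 - (?h * qp a x) ^ 2))" for x
  define P where "P x = of_real (inverse sqrt_t) * (lpeval a f x * lpeval a (sop f) x * mut a (of_real r) x)" for x
  have hX: "(?h * qp a x) ^ 2 = qp a (of_real r) * qp a (2 * x)" for x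
    unfolding qp_of_real[of a r] real_t_eq qp_double power_mult_distrib
    by (simp only: of_real_mult power2_eq_square)
  obtain I \<nu> where I: "((\<lambda>y. G (of_real 0 + \<i> * of_real y)) has_integral I) {- (pi * a)..pi * a}"
    "((\<lambda>y. G (of_real (1 / 4) + \<i> * of_real y)) has_integral (I + of_real \<nu>)) {- (pi * a)..pi * a}" "0 \<le> \<nu>"
    using contour_shift unfolding G_def by blast
  obtain c where c: "\<And>x. \<bar>Re x\<bar> < (1 + r) / 2 \<Longrightarrow> laurent c (qp a x) (lpeval a f x * lpeval a (sop f) x * mut a (of_real r) x)"
    using laurent_lpeval_mut[OF a Re_of_real_gt f fsupp_sop[OF f]] by auto
  then have P: "laurent (\<lambda>n. of_real (inverse sqrt_t) * c n) (qp a x) (P x)" if "\<bar>Re x\<bar> < (1 + Re (of_real r)) / 2" for x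
    unfolding P_def using that by (intro laurent_cmult) simp
  have "laurent (\<lambda>n. of_real (inverse sqrt_t) * c n) (qp a (of_real 0 + \<i> * of_real y)) (P (of_real 0 + \<i> * of_real y))" for y
    using r by (intro P) simp
  from has_integral_laurent[OF a this] obtain J where
    J: "((\<lambda>y. P (of_real 0 + \<i> * of_real y)) has_integral J) {- (pi * a)..pi * a}"
    by blast
  have "((\<lambda>y. P (of_real (1 / 4) + \<i> * of_real y) + G (of_real (1 / 4) + \<i> * of_real y)) has_integral (J + (I + of_real \<nu>)))
      {- (pi * a)..pi * a}"
    by (rule has_integral_add[OF contour_independence[OF a Re_of_real_gt P J] I(2)])
  moreover have "P x + G x = integrand a (of_real r) f f x" if "Re x = 1 / 4" for x
  proof -
    have "integrand a (of_real r) f f x = qp a (- of_real r / 2) * lpeval a f x * lpeval a f (- x) * mut a (of_real r) x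
      + (qp a (of_real r / 2) - qp a (- of_real r / 2)) *
        (lpeval a f x * lpeval a f x * mut a (of_real r) x / (1 - qp a (of_real r) * qp a (2 * x)))"
      by (rule integrand_eq[OF a Re_of_real_gt f f]) (use r that qp_double_neq_1[OF a, of x] in auto)
    then show ?thesis
      unfolding P_def G_def hX qp_half lpeval_sop[OF f] by (simp only: of_real_diff mult.assoc)
  qed
  ultimately have "((\<lambda>y. integrand a (of_real r) f f (1 / 4 + \<i> * of_real y)) has_integral (J + (I + of_real \<nu>)))
      {- (pi * a)..pi * a}"
    by simp
  then have form: "2 * of_real pi * of_real a * form a (of_real r) f f = J + (I + of_real \<nu>)"
    using form_has_integral[OF a Re_of_real_gt f f] by (rule has_integral_unique[rotated])
  define W where "W y = Re (P (\<i> * of_real y) + G (\<i> * of_real y))" for y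
  have "((\<lambda>y. P (\<i> * of_real y) + G (\<i> * of_real y)) has_integral (J + I)) {- (pi * a)..pi * a}"
    using has_integral_add[OF J I(1)] by simp
  then have W: "(W has_integral Re (J + I)) {- (pi * a)..pi * a}"
    unfolding W_def[abs_def] by (rule has_integral_Re)
  have W_eq: "\<exists>m>0. W y = m * (norm (lpeval a f (\<i> * of_real y)) ^ 2 + Re (of_real (real_t - 1) *
      (lpeval a f (\<i> * of_real y) * lpeval a f (\<i> * of_real y) / (1 - of_real real_t * qp a (2 * (\<i> * of_real y))))))" for y
  proof -
    define x where "x = \<i> * complex_of_real y"
    define w where "w = lpeval a f x"
    obtain m where m: "m > 0" "mut a (of_real r) x = of_real m"
      using mut_on_circle_pos[of y] unfolding x_def by blast
    have "cnj x = - x"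
      by (simp add: x_def)
    then have "lpeval a f (- x) = cnj w"
      using cnj_lpeval[of f a x, OF f_real] by (simp add: w_def)
    then have "P x = of_real (inverse sqrt_t) * (w * cnj w * of_real m)"
      by (simp add: P_def lpeval_sop f m w_def)
    also have "\<dots> = of_real (inverse sqrt_t * m) * of_real (norm w ^ 2)"
      by (simp add: complex_norm_square flip: of_real_power)
    finally have Px: "P x = of_real (inverse sqrt_t * m) * of_real (norm w ^ 2)" .
    \<comment> \<open>This extracts t^(-1/2) from both terms, leaving the expression treated in
      \<open>integrand_on_circle_nonneg\<close>.\<close>
    have HT: "sqrt_t - inverse sqrt_t = inverse sqrt_t * (real_t - 1)"
      unfolding real_t_eq by (simp add: field_simps)
    have "(?h * qp a x) ^ 2 = of_real real_t * qp a (2 * x)"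
      unfolding hX qp_of_real ..
    then have "G x = of_real (inverse sqrt_t * m) * (of_real (real_t - 1) * (w * w / (1 - of_real real_t * qp a (2 * x))))"
      unfolding G_def HT m w_def[symmetric] by (simp add: mult_ac)
    then have "P x + G x = of_real (inverse sqrt_t * m) * (of_real (norm w ^ 2) + of_real (real_t - 1) * (w * w / (1 - of_real real_t * qp a (2 * x))))"
      unfolding Px by (simp only: distrib_left)
    then have "W y = inverse sqrt_t * m * (norm w ^ 2 + Re (of_real (real_t - 1) * (w * w / (1 - of_real real_t * qp a (2 * x)))))"
      unfolding W_def x_def[symmetric] by (simp only: Re_of_real_mult plus_complex.sel Re_complex_of_real)
    then show ?thesis
      unfolding w_def x_def using m by (intro exI[of _ "inverse sqrt_t * m"]) simp
  qed
  have circle: "norm (qp a (2 * (\<i> * of_real y))) = 1" for y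
    by (simp add: norm_qp)
  have W_nonneg: "0 \<le> W y" for y
    using W_eq[of y] integrand_on_circle_nonneg[OF circle exp_gt_zero] by (auto intro: mult_nonneg_nonneg)
  have cont: "continuous_on {- (pi * a)..pi * a} W"
  proof -
    have l: "continuous_on S (\<lambda>y::real. lpeval a g (\<i> * of_real y))" for g S
      by (rule continuous_on_compose2[OF holomorphic_on_imp_continuous_on[OF holomorphic_lpeval[of a g UNIV]]])
         (auto intro!: continuous_intros)
    have m: "continuous_on S (\<lambda>y. mut a (of_real r) (\<i> * of_real y))" for S
      using continuous_on_mut by (rule continuous_on_subset) simp
    have cG: "continuous_on {- (pi * a)..pi * a} (\<lambda>y. G (\<i> * of_real y))"
    proof (cases "r = 0")
      case True
      then show ?thesis by (simp add: G_def)
    next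
      case False
      \<comment> \<open>On the imaginary axis (t^(1/2) X)^2 has modulus t, which differs from 1 when
        r is nonzero.\<close>
      have "1 - (?h * qp a (\<i> * of_real y)) ^ 2 \<noteq> 0" for y
      proof
        assume "1 - (?h * qp a (\<i> * of_real y)) ^ 2 = 0"
        then have "norm ((?h * qp a (\<i> * of_real y)) ^ 2) = 1"
          by (metis eq_iff_diff_eq_0 norm_one)
        then have "sqrt_t ^ 2 = 1"
          by (simp add: norm_power norm_mult norm_qp)
        then show False
          using False a by (simp add: power2_eq_square flip: exp_add)
      qed
      then show ?thesis
        unfolding G_def by (intro continuous_intros l m) auto
    qed
    show ?thesis
      unfolding W_def P_def by (intro continuous_intros l m cG)
  qed
  have "Re (J + I) \<noteq> 0"
  proof
    assume "Re (J + I) = 0"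
    then have "integral {- (pi * a)..pi * a} W = 0"
      using W by (simp add: integral_unique)
    then have W0: "W y = 0" if "y \<in> {- (pi * a)..pi * a}" for y
      using integral_eq_0_iff[OF cont _ W_nonneg] a that by simp
    \<comment> \<open>On this open segment X^2 is never 1, so \<open>W y\<close> = 0 forces f(x) =
      0. The segment has limit points, and the identity theorem then gives f = 0.\<close>
    define U where "U = (\<lambda>y. \<i> * complex_of_real y) ` {0<..<pi * a}"
    have zero: "lpeval a f x = 0" if "x \<in> U" for x
    proof (rule ccontr)
      assume nz: "lpeval a f x \<noteq> 0"
      obtain y where y: "x = \<i> * of_real y" "0 < y" "y < pi * a"
        using \<open>x \<in> U\<close> by (auto simp: U_def)
      have "qp a (2 * (\<i> * of_real y)) \<noteq> 1"
      proof
        assume "qp a (2 * (\<i> * of_real y)) = 1"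
        then have "exp (of_real (- 2 * y / a) * \<i>) = 1"
          by (simp add: qp_def mult_ac)
        then obtain n where n: "- 2 * y / a = of_int (2 * n) * pi"
          unfolding exp_eq_1 by auto
        then have yn: "y = real_of_int (- n) * (pi * a)"
          using a by (simp add: field_simps)
        have p: "0 < pi * a"
          using a by simp
        have "0 < real_of_int (- n) * (pi * a)" "real_of_int (- n) * (pi * a) < 1 * (pi * a)"
          using y(2,3) unfolding yn by (simp_all only: mult_1)
        then have "0 < real_of_int (- n)" "real_of_int (- n) < 1"
          using zero_less_mult_pos2[OF _ p] mult_less_cancel_right_pos[OF p] by blast+
        then have "0 < - n" "- n < 1"
          by (simp_all only: of_int_0_less_iff of_int_less_1_iff)
        then show False
          by linarith
      qed
      from integrand_on_circle_pos[OF circle exp_gt_zero this, of "lpeval a f x" "- r / a"] W_eq[of y] nz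
      have "0 < W y"
        unfolding y(1) by auto
      then show False
        using W0[of y] y by simp
    qed
    have "\<i> * of_real (pi * a / 2) \<in> U" "\<i> * of_real (pi * a / 3) \<in> U"
      unfolding U_def using a by (intro imageI; simp)+
    moreover have "\<i> * complex_of_real (pi * a / 2) \<noteq> \<i> * of_real (pi * a / 3)"
      using a by simp
    moreover have "connected U"
      unfolding U_def by (intro connected_continuous_image continuous_intros) simp
    ultimately have "\<i> * of_real (pi * a / 2) islimpt U"
      by (intro connected_imp_perfect) auto
    then have "lpeval a f x = 0" for x
      by (rule analytic_continuation[OF holomorphic_lpeval open_UNIV connected_UNIV subset_UNIV UNIV_I
            _ zero UNIV_I])
    then have "f = (\<lambda>_. 0)"
      by (intro lpeval_unique[OF a f fsupp_0]) (simp add: lpeval_def)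
    then show False
      using f_nz by simp
  qed
  moreover have "0 \<le> Re (J + I)"
    using W by (rule has_integral_nonneg) (rule W_nonneg)
  ultimately have "0 < Re (J + (I + of_real \<nu>))"
    using I(3) by simp
  then have "0 < Re (of_real (2 * pi * a) * form a (of_real r) f f)"
    unfolding form[symmetric] by (simp add: mult.assoc)
  then have "0 < 2 * pi * a * Re (form a (of_real r) f f)"
    by (simp only: Re_of_real_mult)
  then show ?thesis
    by (rule zero_less_mult_pos) (use a in simp)
qed

end

section \<open>Assembly of the three claims\<close>

theorem theorem5p1:
  fixes a :: real and f g :: "int \<Rightarrow> complex"
  assumes "0 < a" and "fsupp f" and "fsupp g"
  shows "(\<forall>k. - 1 / 2 < Re k \<longrightarrow> form14 a k f g = form a k f g)
    \<and> mero_eq (\<lambda>k. form a k f g) (\<lambda>k. form a k g f)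
    \<and> (\<forall>H. mero_eq (\<lambda>k. form a k (hact a k H f) g) (\<lambda>k. form a k f (hact a k (dia H) g)))
    \<and> (\<forall>r::real. - 1 / 2 < r \<longrightarrow>
         (\<forall>h. fsupp h \<and> (\<forall>n. h n \<in> \<real>) \<and> h \<noteq> (\<lambda>_. 0) \<longrightarrow>
            Im (form14 a (of_real r) h h) = 0 \<and> 0 < Re (form14 a (of_real r) h h)))"
proof (intro conjI allI impI)
  show "form14 a k f g = form a k f g" if "- 1 / 2 < Re k" for k
    by (rule form14_eq_form[OF assms(1) that assms(2,3)])
  show "mero_eq (\<lambda>k. form a k f g) (\<lambda>k. form a k g f)"
    by (intro mero_eqI form_symmetric assms)
  show "mero_eq (\<lambda>k. form a k (hact a k H f) g) (\<lambda>k. form a k f (hact a k (dia H) g))" for H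
    by (intro mero_eqI form_hact assms)
next
  fix r :: real and h
  assume r: "- 1 / 2 < r" and h: "fsupp h \<and> (\<forall>n. h n \<in> \<real>) \<and> h \<noteq> (\<lambda>_. 0)"
  have eq: "form14 a (of_real r) h h = form a (of_real r) h h"
    by (rule form14_eq_form) (use assms r h in auto)
  show "Im (form14 a (of_real r) h h) = 0"
    unfolding eq by (rule form_real) (use assms r h in auto)
  show "0 < Re (form14 a (of_real r) h h)"
    unfolding eq by (rule form_pos) (use assms r h in auto)
qed

end
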